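(* Let $W$ be an irreducible complex reflection group, and let $T$ be the set of all reflections in $W$. Then the Cayley graph $\Gamma(W,T)$ is distance integral; that is, every eigenvalue of its distance matrix is an integer.
   Context: Let $V$ be a finite-dimensional complex vector space of dimension $n$. A reflection on $V$ is a linear transformation of $V$ of finite order whose eigenspace for eigenvalue $1$ has dimension $n-1$. A complex reflection group $W$ on $V$ is a finite subgroup of $\mathrm{GL}(V)$ generated by reflections (and $V$ carries a $W$-invariant hermitian form). It is irreducible if it acts irreducibly on the orthogonal complement of its fixed point space (the fixed point space may be zero). The set $T$ of all reflections in $W$ generates $W$ and is closed under inversion and conjugation. The (left) Cayley graph $\Gamma(W,T)$ is the undirected graph with vertex set $W$ and an edge joining $g$ and $tg$ for each $g\in W$, $t\in T$. Its distance matrix $D$ has rows and columns indexed by $W$, with $(g,h)$-entry the minimal length of a path from $g$ to $h$ in $\Gamma(W,T)$. A graph is distance integral if all eigenvalues of its distance matrix are integers. *)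

theory Defs
  imports
    Complex_Main
    "HOL-Algebra.Generated_Groups"
    "Graph_Theory.Pair_Digraph"
    "Jordan_Normal_Form.Char_Poly"
begin

section \<open>Complex reflection groups\<close>

text \<open>
  A vector space \<open>V\<close> is a type \<open>'b\<close> together with a scalar multiplication in the sense of
  \<^locale>\<open>vector_space\<close>. Qualified names are used because HOL-Algebra and the matrix
  library have notions of their own for linear algebra over explicit carriers.
\<close>

context vector_space
begin

definition general_linear_group :: "('b \<Rightarrow> 'b) monoid" where
  "general_linear_group =
     \<lparr>carrier = {f. Vector_Spaces.linear scale scale f \<and> bij f}, monoid.mult = (\<circ>), one = id\<rparr>"

text \<open>The codimension is stated as an addition because subtraction on naturals truncates.\<close>

definition reflection :: "('b \<Rightarrow> 'b) \<Rightarrow> bool" where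
  "reflection t \<longleftrightarrow>
     Vector_Spaces.linear scale scale t \<and>
     (\<exists>k>0. t ^^ k = id) \<and>
     dim {v. t v = v} + 1 = dim UNIV"

definition fixed_space :: "('b \<Rightarrow> 'b) set \<Rightarrow> 'b set" where
  "fixed_space W = {v. \<forall>w\<in>W. w v = v}"

definition acts_irreducibly_on :: "('b \<Rightarrow> 'b) set \<Rightarrow> 'b set \<Rightarrow> bool" where
  "acts_irreducibly_on W U \<longleftrightarrow>
     subspace U \<and> (\<forall>w\<in>W. w ` U \<subseteq> U) \<and> U \<noteq> {0} \<and>
     (\<forall>S. subspace S \<and> S \<subseteq> U \<and> (\<forall>w\<in>W. w ` S \<subseteq> S) \<longrightarrow> S = {0} \<or> S = U)"

end

text \<open>
  A positive definite hermitian form, linear in the first argument. Hermitian symmetry makes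
  \<open>form v v\<close> real, so positivity may be stated for its real part.
\<close>

definition hermitian_form ::
    "(complex \<Rightarrow> 'v \<Rightarrow> 'v) \<Rightarrow> ('v::ab_group_add \<Rightarrow> 'v \<Rightarrow> complex) \<Rightarrow> bool" where
  "hermitian_form scale form \<longleftrightarrow>
     (\<forall>u v w. form (u + v) w = form u w + form v w) \<and>
     (\<forall>c v w. form (scale c v) w = c * form v w) \<and>
     (\<forall>v w. form w v = cnj (form v w)) \<and>
     (\<forall>v. v \<noteq> 0 \<longrightarrow> Re (form v v) > 0)"

definition orthogonal_complement ::
    "('v \<Rightarrow> 'v \<Rightarrow> complex) \<Rightarrow> 'v set \<Rightarrow> 'v set" where
  "orthogonal_complement form S = {v. \<forall>s\<in>S. form v s = 0}"

locale complex_reflection_group = finite_dimensional_vector_space scale Basis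
  for scale :: "complex \<Rightarrow> 'v::ab_group_add \<Rightarrow> 'v"
    and Basis :: "'v set" +
  fixes form :: "'v \<Rightarrow> 'v \<Rightarrow> complex"
    and W :: "('v \<Rightarrow> 'v) set"
  assumes hermitian: "hermitian_form scale form"
    and subgroup_GL: "subgroup W general_linear_group"
    and finite_group: "finite W"
    and generated: "\<exists>S. S \<subseteq> Collect reflection \<and> W = generate general_linear_group S"
    and invariant: "\<And>w u v. w \<in> W \<Longrightarrow> form (w u) (w v) = form u v"

locale irreducible_complex_reflection_group = complex_reflection_group +
  assumes irreducible: "acts_irreducibly_on W (orthogonal_complement form (fixed_space W))"

section \<open>Cayley graphs and distance integrality\<close>

text \<open>As in Graph_Theory, an undirected graph is a digraph with a symmetric set of arcs.\<close>

definition cayley_graph :: "('a, 'c) monoid_scheme \<Rightarrow> 'a set \<Rightarrow> 'a pair_pre_digraph" where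
  "cayley_graph G T =
     \<lparr>pverts = carrier G,
      parcs = {(g, t \<otimes>\<^bsub>G\<^esub> g) | g t. g \<in> carrier G \<and> t \<in> T} \<union>
              {(t \<otimes>\<^bsub>G\<^esub> g, g) | g t. g \<in> carrier G \<and> t \<in> T}\<rparr>"

context pre_digraph
begin

text \<open>Only meaningful if there is a path from \<open>u\<close> to \<open>v\<close>; otherwise the value is unspecified.\<close>

definition graph_distance :: "'a \<Rightarrow> 'a \<Rightarrow> nat" where
  "graph_distance u v = (LEAST k. \<exists>p. apath u p v \<and> length p = k)"

text \<open>
  Matrices are indexed by natural numbers, so the vertices are enumerated by a list \<open>vs\<close>.
  Different enumerations give matrices conjugate by a permutation matrix.
\<close>

definition distance_matrix :: "'a list \<Rightarrow> complex mat" where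
  "distance_matrix vs =
     mat (length vs) (length vs) (\<lambda>(i, j). of_nat (graph_distance (vs ! i) (vs ! j)))"

definition distance_integral :: bool where
  "distance_integral \<longleftrightarrow>
     finite (verts G) \<and>
     (\<forall>vs. distinct vs \<and> set vs = verts G \<longrightarrow>
       (\<forall>x. eigenvalue (distance_matrix vs) x \<longrightarrow> x \<in> \<int>))"

end

end

theory Submission
  imports Defs "HOL-Number_Theory.Number_Theory" "HOL-Library.Function_Algebras"
    "Jordan_Normal_Form.Schur_Decomposition"
begin

text \<open>
  Let \<open>l\<close> be the word length with respect to the reflections \<open>T\<close>; it is a class function, since
  \<open>T\<close> is closed under conjugation. The theorem rests on \<open>l (w ^ a) = l w\<close> for \<open>a\<close> coprime to the
  group order \<open>n\<close>. To see this, note that \<open>T\<close> is closed under such powers, because \<open>t\<close> and \<open>t ^ a\<close>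
  fix the same vectors. For a class function \<open>f\<close> and a large prime \<open>p\<close>, rotating factorizations of
  length \<open>p\<close> gives \<open>f\<^sup>*\<^sup>p (h ^ p) \<equiv> f h\<close> modulo \<open>p\<close> for the \<open>p\<close>-th convolution power. Applied to the
  indicator function of \<open>T\<close> and to its \<open>k\<close>-th power, this shows that \<open>h\<close> and \<open>h ^ p\<close> have the same number
  modulo \<open>p\<close> of factorizations into \<open>k\<close> elements of \<open>T\<close>. Finally \<open>a\<close> is congruent modulo \<open>n\<close> to a product of
  large primes.

  Let \<open>x\<close> be an eigenvalue of the distance matrix. The group acts on the eigenspace \<open>E\<close> by translations
  \<open>\<rho>\<close>, and \<open>x * dim E\<close> is the sum of all \<open>l w * tr (\<rho> w)\<close>. Averaging over the substitutions
  \<open>w \<mapsto> w ^ a\<close> replaces \<open>tr (\<rho> w)\<close> by an average of the \<open>tr (\<rho> w ^ a)\<close>, whose sum is an integer because it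
  is a sum of Ramanujan sums. So \<open>x\<close> is rational, and it is an algebraic integer.
\<close>

section \<open>Ramanujan sums\<close>

lemma sum_powers_root_of_unity:
  fixes z :: complex
  assumes "z ^ n = 1"
  shows "(\<Sum>k\<in>{0<..n}. z ^ k) \<in> \<int>"
proof (cases "z = 1")
  case False
  have "(\<Sum>k\<in>{0<..n}. z ^ k) = z * (\<Sum>k<n. z ^ k)"
    unfolding sum_distrib_left
    by (rule sum.reindex_bij_witness[of _ Suc "\<lambda>k. k - 1"])
       (auto simp flip: power_Suc)
  also have "(\<Sum>k<n. z ^ k) = 0"
    using geometric_sum[OF False, of n] assms by simp
  finally show ?thesis by simp
qed simp

text \<open>Sort the exponents in \<open>{0<..n}\<close> by their gcd \<open>d\<close> with
  \<open>n\<close>. The class of \<open>d\<close> contributes the analogous sum for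
  \<open>z ^ d\<close> and \<open>n div d\<close>, an integer by induction if
  \<open>d \<noteq> 1\<close>; the class of 1 is the claimed sum, and all classes together add up to
  an integer.\<close>

lemma ramanujan_sum_Ints:
  fixes z :: complex
  assumes "n > 0" "z ^ n = 1"
  shows "(\<Sum>a\<in>totatives n. z ^ a) \<in> \<int>"
  using assms
proof (induction n arbitrary: z rule: less_induct)
  case (less n)
  define A where "A d = {k\<in>{0<..n}. gcd k n = d}" for d
  have A1: "A 1 = totatives n"
    by (auto simp: A_def totatives_def intro: gcd_eq_1_imp_coprime)
  have fin: "finite {d. d dvd n}"
    using less.prems by (simp add: finite_divisors_nat)
  have "{0<..n} = (\<Union>d\<in>{d. d dvd n}. A d)"
    by (auto simp: A_def)
  then have "(\<Sum>k\<in>{0<..n}. z ^ k) = (\<Sum>k\<in>(\<Union>d\<in>{d. d dvd n}. A d). z ^ k)"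
    by simp
  also have "\<dots> = (\<Sum>d\<in>{d. d dvd n}. \<Sum>k\<in>A d. z ^ k)"
    by (rule sum.UNION_disjoint) (use fin in \<open>auto simp: A_def\<close>)
  also have "\<dots> = (\<Sum>a\<in>totatives n. z ^ a) + (\<Sum>d\<in>{d. d dvd n} - {1}. \<Sum>k\<in>A d. z ^ k)"
    by (subst sum.remove[of _ 1]) (use fin A1 in auto)
  finally have "(\<Sum>a\<in>totatives n. z ^ a) =
      (\<Sum>k\<in>{0<..n}. z ^ k) - (\<Sum>d\<in>{d. d dvd n} - {1}. \<Sum>k\<in>A d. z ^ k)"
    by simp
  moreover have "(\<Sum>k\<in>A d. z ^ k) \<in> \<int>" if d: "d dvd n" "d \<noteq> 1" for d
  proof -
    have "(\<Sum>k\<in>A d. z ^ k) = (\<Sum>a\<in>totatives (n div d). z ^ (a * d))"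
      unfolding A_def
      by (rule sum.reindex_bij_betw[symmetric, OF bij_betw_totatives_gcd_eq])
         (use d less.prems in auto)
    also have "\<dots> = (\<Sum>a\<in>totatives (n div d). (z ^ d) ^ a)"
      by (simp add: mult.commute flip: power_mult)
    also have "\<dots> \<in> \<int>"
    proof (rule less.IH)
      have "d \<noteq> 0" using d less.prems by auto
      then show "n div d < n" "0 < n div d"
        using d less.prems by (auto simp: dvd_imp_le div_greater_zero_iff intro!: div_less_dividend)
      show "(z ^ d) ^ (n div d) = 1"
        using d less.prems by (simp flip: power_mult)
    qed
    finally show ?thesis .
  qed
  then have "(\<Sum>d\<in>{d. d dvd n} - {1}. \<Sum>k\<in>A d. z ^ k) \<in> \<int>"
    by (rule Ints_sum) auto
  ultimately show ?case
    using sum_powers_root_of_unity[OF less.prems(2)] by (simp add: Ints_diff)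
qed

section \<open>Traces of linear maps of finite order\<close>

definition mat_trace :: "'a :: comm_ring_1 mat \<Rightarrow> 'a" where
  "mat_trace A = (\<Sum>i<dim_row A. A $$ (i, i))"

lemma mat_trace_comm:
  assumes "A \<in> carrier_mat n m" "B \<in> carrier_mat m n"
  shows "mat_trace (A * B) = mat_trace (B * A)"
proof -
  have "mat_trace (A * B) = (\<Sum>i<n. \<Sum>j<m. A $$ (i, j) * B $$ (j, i))"
    using assms by (auto simp: mat_trace_def scalar_prod_def atLeast0LessThan intro!: sum.cong)
  also have "\<dots> = (\<Sum>j<m. \<Sum>i<n. B $$ (j, i) * A $$ (i, j))"
    by (subst sum.swap) (simp add: mult.commute)
  also have "\<dots> = mat_trace (B * A)"
    using assms by (auto simp: mat_trace_def scalar_prod_def atLeast0LessThan intro!: sum.cong)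
  finally show ?thesis .
qed

text \<open>In an entry \<open>(i, j)\<close> of a product with \<open>j \<le> i\<close>, the left
  factor kills the terms with \<open>l < i\<close> and the right factor those with
  \<open>l > j\<close>. Nothing survives below the diagonal, and diagonal entries multiply.\<close>

lemma upper_triangular_pow:
  fixes B :: "'a :: comm_ring_1 mat"
  assumes B: "B \<in> carrier_mat n n" and ut: "upper_triangular B"
  shows "upper_triangular (B ^\<^sub>m k) \<and> (\<forall>i<n. (B ^\<^sub>m k) $$ (i, i) = (B $$ (i, i)) ^ k)"
proof (induction k)
  case (Suc k)
  let ?C = "B ^\<^sub>m k"
  have C: "?C \<in> carrier_mat n n" using B by simp
  have entry: "(?C * B) $$ (i, j) = (\<Sum>l<n. ?C $$ (i, l) * B $$ (l, j))" if "i < n" "j < n" for i j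
    using that B C by (auto simp: scalar_prod_def atLeast0LessThan intro!: sum.cong)
  have C0: "?C $$ (i, l) = 0" if "l < i" "i < n" for i l
    using Suc that C by (auto simp: upper_triangular_def)
  have B0: "B $$ (i, l) = 0" if "l < i" "i < n" for i l
    using ut that B by (auto simp: upper_triangular_def)
  have "(?C * B) $$ (i, j) = 0" if "j < i" "i < n" for i j
    unfolding entry[OF that(2) less_trans[OF that]]
  proof (rule sum.neutral, safe)
    fix l assume "l < n"
    then show "?C $$ (i, l) * B $$ (l, j) = 0"
      using C0[of l i] B0[of j l] that by (cases "l < i") auto
  qed
  moreover have "(?C * B) $$ (i, i) = (B $$ (i, i)) ^ Suc k" if "i < n" for i
  proof -
    have "(?C * B) $$ (i, i) = (\<Sum>l<n. if l = i then ?C $$ (i, i) * B $$ (i, i) else 0)"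
      unfolding entry[OF that that]
      by (rule sum.cong) (use C0[of _ i] B0[of i] that in \<open>auto simp: neq_iff\<close>)
    then show ?thesis using Suc that by (simp add: mult.commute)
  qed
  ultimately show ?case using B C by (auto simp: upper_triangular_def)
qed (use B in auto)

text \<open>Schur triangularization conjugates \<open>A\<close> to a triangular \<open>B\<close>
  whose diagonal entries are \<open>n\<close>-th roots of unity. The trace of a power of
  \<open>A\<close> is a power sum of these entries, so the sum over \<open>a\<close> is one
  Ramanujan sum per entry.\<close>

lemma finite_order_mat_trace_Ints:
  fixes A :: "complex mat"
  assumes A: "A \<in> carrier_mat m m" and pow: "A ^\<^sub>m n = 1\<^sub>m m" and n: "n > 0"
  shows "(\<Sum>a\<in>totatives n. mat_trace (A ^\<^sub>m a)) \<in> \<int>"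
proof -
  obtain es where "char_poly A = (\<Prod>a\<leftarrow>es. [:- a, 1:])"
    using char_poly_factorized[OF A] by auto
  then obtain B where B: "B \<in> carrier_mat m m" "upper_triangular B" "similar_mat A B"
    using schur_decomposition_exists[OF A] by blast
  then obtain P Q where w: "similar_mat_wit A B P Q"
    by (auto simp: similar_mat_def)
  note w' = similar_mat_witD2[OF A w]
  have powB: "A ^\<^sub>m k = P * B ^\<^sub>m k * Q" for k
    by (rule similar_mat_wit_pow_id[OF w])
  \<comment> \<open>Cyclicity of the trace cancels the conjugating matrices \<open>P\<close> and
    \<open>Q\<close>.\<close>
  have tr: "mat_trace (A ^\<^sub>m k) = (\<Sum>i<m. (B $$ (i, i)) ^ k)" for k
  proof -
    have Bk: "B ^\<^sub>m k \<in> carrier_mat m m" using B by simp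
    have "mat_trace (A ^\<^sub>m k) = mat_trace (P * (B ^\<^sub>m k * Q))"
      using powB w' Bk by (simp add: assoc_mult_mat[of P m m _ m _ m])
    also have "\<dots> = mat_trace (B ^\<^sub>m k * Q * P)"
      using w' Bk by (intro mat_trace_comm[of _ m m]) auto
    also have "B ^\<^sub>m k * Q * P = B ^\<^sub>m k"
      using w' Bk by (simp add: assoc_mult_mat[of _ m m _ m _ m])
    finally show ?thesis
      using upper_triangular_pow[OF B(1,2), of k] B(1) by (simp add: mat_trace_def)
  qed
  have "B ^\<^sub>m n = Q * A ^\<^sub>m n * P"
    by (rule similar_mat_wit_pow_id[OF similar_mat_wit_sym[OF w]])
  then have "B ^\<^sub>m n = Q * 1\<^sub>m m * P"
    unfolding pow .
  then have "B ^\<^sub>m n = 1\<^sub>m m" using w' by (simp add: right_mult_one_mat[of _ m])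
  then have unity: "(B $$ (i, i)) ^ n = 1" if "i < m" for i
    using upper_triangular_pow[OF B(1,2), of n] that by auto
  have "(\<Sum>a\<in>totatives n. mat_trace (A ^\<^sub>m a)) = (\<Sum>i<m. \<Sum>a\<in>totatives n. (B $$ (i, i)) ^ a)"
    unfolding tr by (rule sum.swap)
  also have "\<dots> \<in> \<int>"
    by (intro Ints_sum ramanujan_sum_Ints) (use unity n in auto)
  finally show ?thesis .
qed

text \<open>
  This is the trace of the restriction of \<open>f\<close> to the span of \<open>B\<close> if \<open>B\<close> is finite and independent and
  \<open>f\<close> preserves its span.
\<close>

definition span_trace ::
    "(complex \<Rightarrow> 'b::ab_group_add \<Rightarrow> 'b) \<Rightarrow> 'b set \<Rightarrow> ('b \<Rightarrow> 'b) \<Rightarrow> complex" where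
  "span_trace scale B f = (\<Sum>b\<in>B. Modules.module.representation scale B (f b) b)"

lemma linear_funpow:
  assumes "Vector_Spaces.linear scale scale f"
  shows "Vector_Spaces.linear scale scale (f ^^ k)"
proof -
  interpret f: Vector_Spaces.linear scale scale f by fact
  show ?thesis
  proof (induction k)
    case 0
    show ?case using f.vs1.linear_ident by (simp add: id_def)
  next
    case (Suc k)
    then show ?case
      using module_hom_compose[of scale scale "f ^^ k" scale f] assms by (simp add: linear_iff_module_hom o_def)
  qed
qed

text \<open>The columns of \<open>M f\<close> express \<open>f\<close> on the basis
  \<open>B\<close>, and powers of \<open>f\<close> become matrix powers, which reduces the claim to
  matrices. Finite order is required on the span only, because \<open>f\<close> may fail to have it
  on the whole space.\<close>

lemma span_trace_funpow_Ints:
  fixes scale :: "complex \<Rightarrow> 'b::ab_group_add \<Rightarrow> 'b"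
  assumes lin: "Vector_Spaces.linear scale scale f"
    and indep: "\<not> Modules.module.dependent scale B"
    and fin: "finite B"
    and inv: "\<And>v. v \<in> Modules.module.span scale B \<Longrightarrow> f v \<in> Modules.module.span scale B"
    and pow: "\<And>v. v \<in> Modules.module.span scale B \<Longrightarrow> (f ^^ n) v = v"
    and n: "n > 0"
  shows "(\<Sum>a\<in>totatives n. span_trace scale B (f ^^ a)) \<in> \<int>"
proof -
  interpret f: Vector_Spaces.linear scale scale f by fact
  let ?rep = "f.vs1.representation B"
  obtain bs where bs: "set bs = B" "distinct bs"
    using fin finite_distinct_list by blast
  define m where "m = length bs"
  have bsB: "bs ! i \<in> B" if "i < m" for i
    using that bs by (auto simp: m_def)
  have sum_B: "(\<Sum>b\<in>B. h b) = (\<Sum>i<m. h (bs ! i))" for h :: "'b \<Rightarrow> complex"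
    unfolding bs(1)[symmetric] m_def
    by (rule sum.reindex_bij_betw[OF bij_betw_nth[OF bs(2) refl refl], symmetric])
  define M where "M g = mat m m (\<lambda>(i, j). ?rep (g (bs ! j)) (bs ! i))" for g
  have M_carrier [simp]: "M g \<in> carrier_mat m m" for g
    by (simp add: M_def)
  have trace: "mat_trace (M g) = span_trace scale B g" for g
    by (simp add: mat_trace_def span_trace_def sum_B M_def)
  have rep_bs: "?rep (bs ! j) (bs ! i) = (if i = j then 1 else 0)" if "i < m" "j < m" for i j
    using that bs(2) by (simp add: f.vs1.representation_basis[OF indep bsB] nth_eq_iff_index_eq m_def)
  have inv_pow: "(f ^^ k) v \<in> f.vs1.span B" if "v \<in> f.vs1.span B" for k v
    using that by (induction k) (auto intro: inv)
  have M_pow: "M (f ^^ k) = M f ^\<^sub>m k" for k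
  proof (induction k)
    case 0
    show ?case
      by (rule eq_matI) (auto simp: M_def rep_bs)
  next
    case (Suc k)
    interpret fk: Vector_Spaces.linear scale scale "f ^^ k" by (rule linear_funpow[OF lin])
    have "M (f ^^ Suc k) = M (f ^^ k) * M f"
    proof (rule eq_matI)
      fix i j assume "i < dim_row (M (f ^^ k) * M f)" "j < dim_col (M (f ^^ k) * M f)"
      then have ij: "i < m" "j < m" by (simp_all add: M_def)
      have sp: "f (bs ! j) \<in> f.vs1.span B"
        using ij bsB by (intro inv f.vs1.span_base)
      \<comment> \<open>Expand \<open>f (bs ! j)\<close> in the basis and apply the linear map
        \<open>f ^^ k\<close>; the coefficients form column \<open>j\<close> of
        \<open>M f\<close>.\<close>
      have "(f ^^ k) (f (bs ! j)) = (f ^^ k) (\<Sum>b\<in>B. scale (?rep (f (bs ! j)) b) b)"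
        using f.vs1.sum_representation_eq[OF indep sp fin] by simp
      also have "\<dots> = (\<Sum>b\<in>B. scale (?rep (f (bs ! j)) b) ((f ^^ k) b))"
        by (simp add: fk.sum fk.scale)
      finally have "?rep ((f ^^ k) (f (bs ! j))) (bs ! i) =
          (\<Sum>b\<in>B. ?rep (f (bs ! j)) b * ?rep ((f ^^ k) b) (bs ! i))"
        by (simp add: f.vs1.representation_sum[OF indep] f.vs1.representation_scale[OF indep]
            f.vs1.span_scale inv_pow f.vs1.span_base)
      then show "M (f ^^ Suc k) $$ (i, j) = (M (f ^^ k) * M f) $$ (i, j)"
        using ij by (simp add: M_def sum_B scalar_prod_def atLeast0LessThan funpow_swap1 mult.commute)
    qed (simp_all add: M_def)
    then show ?case using Suc by (simp add: o_def)
  qed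
  have "M f ^\<^sub>m n = 1\<^sub>m m"
    unfolding M_pow[symmetric]
    by (rule eq_matI) (auto simp: M_def rep_bs pow f.vs1.span_base bsB)
  from finite_order_mat_trace_Ints[OF M_carrier this n] show ?thesis
    by (simp add: M_pow[symmetric] trace)
qed

section \<open>Rationality by averaging traces\<close>

text \<open>On the span of \<open>B\<close> the combination is the scalar \<open>x\<close>, with
  trace \<open>x * card B\<close>. The substitution \<open>p a\<close>, an abstract power map, keeps
  the coefficients and turns each operator into its \<open>a\<close>-th power.\<close>

lemma Rats_of_power_invariant_combination:
  fixes scale :: "complex \<Rightarrow> 'b::ab_group_add \<Rightarrow> 'b" and c :: "'i \<Rightarrow> complex"
  assumes vs: "vector_space scale"
    and B: "\<not> Modules.module.dependent scale B" "finite B" "B \<noteq> {}"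
    and lin: "\<And>g. g \<in> I \<Longrightarrow> Vector_Spaces.linear scale scale (\<rho> g)"
    and inv: "\<And>g v. g \<in> I \<Longrightarrow> v \<in> Modules.module.span scale B \<Longrightarrow> \<rho> g v \<in> Modules.module.span scale B"
    and pow: "\<And>g v. g \<in> I \<Longrightarrow> v \<in> Modules.module.span scale B \<Longrightarrow> (\<rho> g ^^ n) v = v"
    and n: "n > 0"
    and bij: "\<And>a. a \<in> totatives n \<Longrightarrow> bij_betw (p a) I I"
    and \<rho>_p: "\<And>a g v. a \<in> totatives n \<Longrightarrow> g \<in> I \<Longrightarrow> v \<in> Modules.module.span scale B \<Longrightarrow>
                \<rho> (p a g) v = (\<rho> g ^^ a) v"
    and c_p: "\<And>a g. a \<in> totatives n \<Longrightarrow> g \<in> I \<Longrightarrow> c (p a g) = c g"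
    and c_Rats: "\<And>g. g \<in> I \<Longrightarrow> c g \<in> \<rat>"
    and eig: "\<And>v. v \<in> Modules.module.span scale B \<Longrightarrow> (\<Sum>g\<in>I. scale (c g) (\<rho> g v)) = scale x v"
  shows "x \<in> \<rat>"
proof -
  interpret vector_space scale by fact
  have tr: "x * of_nat (card B) = (\<Sum>g\<in>I. c g * span_trace scale B (\<rho> g))"
  proof -
    have "x * of_nat (card B) = (\<Sum>b\<in>B. representation B (scale x b) b)"
      by (simp add: representation_scale[OF B(1)] span_base representation_basis[OF B(1)])
    also have "\<dots> = (\<Sum>b\<in>B. \<Sum>g\<in>I. c g * representation B (\<rho> g b) b)"
    proof (rule sum.cong)
      fix b assume b: "b \<in> B"
      have "representation B (scale x b) = representation B (\<Sum>g\<in>I. scale (c g) (\<rho> g b))"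
        using eig b by (simp add: span_base)
      also have "\<dots> = (\<lambda>b'. \<Sum>g\<in>I. c g * representation B (\<rho> g b) b')"
        using b inv by (subst representation_sum[OF B(1)])
          (auto simp: representation_scale[OF B(1)] span_base span_scale)
      finally show "representation B (scale x b) b = (\<Sum>g\<in>I. c g * representation B (\<rho> g b) b)"
        by simp
    qed simp
    also have "\<dots> = (\<Sum>g\<in>I. c g * span_trace scale B (\<rho> g))"
      by (subst sum.swap) (simp add: span_trace_def sum_distrib_left)
    finally show ?thesis .
  qed
  have tr_pow: "x * of_nat (card B) = (\<Sum>g\<in>I. c g * span_trace scale B (\<rho> g ^^ a))"
    if a: "a \<in> totatives n" for a
  proof -
    have "x * of_nat (card B) = (\<Sum>g\<in>I. c (p a g) * span_trace scale B (\<rho> (p a g)))"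
      unfolding tr by (rule sum.reindex_bij_betw[OF bij[OF a], symmetric])
    also have "\<dots> = (\<Sum>g\<in>I. c g * span_trace scale B (\<rho> g ^^ a))"
      using a by (intro sum.cong) (auto simp: c_p span_trace_def \<rho>_p span_base)
    finally show ?thesis .
  qed
  \<comment> \<open>All \<open>totient n\<close> values of \<open>a\<close> give the same number;
    adding them up turns the traces into the integers of
    \<open>span_trace_funpow_Ints\<close>.\<close>
  have "x * of_nat (card B) * of_nat (totient n) =
      (\<Sum>a\<in>totatives n. \<Sum>g\<in>I. c g * span_trace scale B (\<rho> g ^^ a))"
    by (simp add: tr_pow[symmetric] totient_def mult.commute)
  also have "\<dots> = (\<Sum>g\<in>I. c g * (\<Sum>a\<in>totatives n. span_trace scale B (\<rho> g ^^ a)))"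
    by (subst sum.swap) (simp add: sum_distrib_left)
  also have "\<dots> \<in> \<rat>"
  proof (rule Rats_sum)
    fix g assume g: "g \<in> I"
    have "(\<Sum>a\<in>totatives n. span_trace scale B (\<rho> g ^^ a)) \<in> \<int>"
      using lin inv pow g by (intro span_trace_funpow_Ints[OF _ B(1,2) _ _ n]) auto
    then show "c g * (\<Sum>a\<in>totatives n. span_trace scale B (\<rho> g ^^ a)) \<in> \<rat>"
      using c_Rats[OF g] Ints_subset_Rats by (intro Rats_mult) auto
  qed
  finally have "x * of_nat (card B) * of_nat (totient n) \<in> \<rat>" .
  moreover have "card B \<noteq> 0" "totient n \<noteq> 0"
    using B n by auto
  ultimately have "x * of_nat (card B) * of_nat (totient n) / (of_nat (card B) * of_nat (totient n)) \<in> \<rat>"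
    by (intro Rats_divide) auto
  then show ?thesis using \<open>card B \<noteq> 0\<close> \<open>totient n \<noteq> 0\<close> by simp
qed

section \<open>Coprime powers and conjugation in finite groups\<close>

lemma (in group) nat_pow_cong:
  assumes fin: "finite (carrier G)" and x: "x \<in> carrier G" and c: "[i = j] (mod Coset.order G)"
  shows "x [^] (i::nat) = x [^] (j::nat)"
proof -
  have "x [^] k = x [^] (k mod Coset.order G)" for k :: nat
  proof -
    have "x [^] k = x [^] (Coset.order G * (k div Coset.order G) + k mod Coset.order G)"
      by simp
    also have "\<dots> = (x [^] Coset.order G) [^] (k div Coset.order G) \<otimes> x [^] (k mod Coset.order G)"
      using x by (simp only: nat_pow_mult nat_pow_pow)
    also have "\<dots> = x [^] (k mod Coset.order G)"
      using x fin by (simp add: pow_order_eq_1)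
    finally show ?thesis .
  qed
  then show ?thesis using c by (metis cong_def)
qed

text \<open>Take \<open>b\<close> inverse to \<open>a\<close> modulo the group order. Undoing a
  coprime power by another one turns closure statements into equivalences.\<close>

lemma (in group) coprime_power_inverse:
  assumes fin: "finite (carrier G)" and cop: "coprime a (Coset.order G)"
  obtains b :: nat where "coprime b (Coset.order G)" "\<And>x. x \<in> carrier G \<Longrightarrow> (x [^] a) [^] b = x"
proof -
  obtain b where b: "[a * b = Suc 0] (mod Coset.order G)"
    using cong_solve_coprime_nat[OF cop] by auto
  have "coprime b (Coset.order G)"
    using b coprime_iff_invertible_nat by (metis mult.commute)
  moreover have "(x [^] a) [^] b = x" if x: "x \<in> carrier G" for x
    using nat_pow_cong[OF fin x b] x by (simp add: nat_pow_pow)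
  ultimately show ?thesis using that by blast
qed

lemma (in group) bij_betw_pow_coprime:
  fixes a :: nat
  assumes fin: "finite (carrier G)" and cop: "coprime a (Coset.order G)"
  shows "bij_betw (\<lambda>x. x [^] a) (carrier G) (carrier G)"
proof -
  obtain b :: nat where "\<And>x. x \<in> carrier G \<Longrightarrow> (x [^] a) [^] b = x"
    using coprime_power_inverse[OF assms] by metis
  then have "inj_on (\<lambda>x. x [^] a) (carrier G)"
    by (intro inj_onI) metis
  then show ?thesis
    using fin by (intro bij_betw_imageI endo_inj_surj) auto
qed

lemma (in group) bij_betw_conjugation:
  assumes "finite (carrier G)" "u \<in> carrier G"
  shows "bij_betw (\<lambda>w. u \<otimes> w \<otimes> inv u) (carrier G) (carrier G)"
proof -
  have "inj_on (\<lambda>w. u \<otimes> w \<otimes> inv u) (carrier G)"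
    by (rule inj_onI) (use assms in simp)
  then show ?thesis
    using assms by (intro bij_betw_imageI endo_inj_surj) auto
qed

text \<open>The solutions of the eigenvalue equation form a space \<open>E\<close>. Since
  \<open>d\<close> is a class function, translating a solution gives a solution, and
  \<open>Rats_of_power_invariant_combination\<close> applies to the translations with the group's
  power maps as \<open>p\<close>.\<close>

lemma (in group) Rats_convolution_eigenvalue:
  fixes d :: "'a \<Rightarrow> nat" and f :: "'a \<Rightarrow> complex"
  assumes fin: "finite (carrier G)"
    and d_conj: "\<And>u w. u \<in> carrier G \<Longrightarrow> w \<in> carrier G \<Longrightarrow> d (u \<otimes> w \<otimes> inv u) = d w"
    and d_pow: "\<And>a w. coprime a (Coset.order G) \<Longrightarrow> w \<in> carrier G \<Longrightarrow> d (w [^] a) = d w"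
    and eig: "\<And>g. g \<in> carrier G \<Longrightarrow> (\<Sum>w\<in>carrier G. of_nat (d w) * f (w \<otimes> g)) = x * f g"
    and nonzero: "\<exists>g\<in>carrier G. f g \<noteq> 0"
  shows "x \<in> \<rat>"
proof -
  define scale :: "complex \<Rightarrow> ('a \<Rightarrow> complex) \<Rightarrow> 'a \<Rightarrow> complex"
    where "scale c h = (\<lambda>y. c * h y)" for c h
  interpret vector_space scale
    by unfold_locales (auto simp: scale_def fun_eq_iff algebra_simps)
  \<comment> \<open>Vanishing off the group makes \<open>E\<close> finite-dimensional even if the
    type is infinite.\<close>
  define E where "E = {h. (\<forall>y. y \<notin> carrier G \<longrightarrow> h y = 0) \<and>
      (\<forall>g\<in>carrier G. (\<Sum>w\<in>carrier G. of_nat (d w) * h (w \<otimes> g)) = x * h g)}"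
  \<comment> \<open>This translation reverses products, which is harmless because only powers of a
    single element occur.\<close>
  define \<rho> where "\<rho> u h = (\<lambda>y. if y \<in> carrier G then h (u \<otimes> y) else 0)"
    for u and h :: "'a \<Rightarrow> complex"
  have "subspace E"
    by (auto simp: subspace_def E_def scale_def distrib_left sum.distrib mult.left_commute
        simp flip: sum_distrib_left)
  have E0: "h y = 0" if "h \<in> E" "y \<notin> carrier G" for h y
    using that by (auto simp: E_def)
  obtain B where B: "B \<subseteq> E" "independent B" "E \<subseteq> span B"
    using maximal_independent_subset by blast
  have span_B: "span B = E"
    using B \<open>subspace E\<close> by (simp add: span_minimal subset_antisym)
  let ?\<delta> = "\<lambda>z y. if y = z then 1 else 0 :: complex"
  \<comment> \<open>The indicator functions of group elements bound the size of the independent set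
    \<open>B\<close>.\<close>
  have "E \<subseteq> span (?\<delta> ` carrier G)"
  proof
    fix h assume h: "h \<in> E"
    have sum_apply: "(\<Sum>z\<in>A. k z) y = (\<Sum>z\<in>A. k z y)" for A :: "'a set" and k :: "'a \<Rightarrow> 'a \<Rightarrow> complex" and y
      by (induction A rule: infinite_finite_induct) auto
    have "h = (\<Sum>z\<in>carrier G. scale (h z) (?\<delta> z))"
    proof
      fix y
      have "(\<Sum>z\<in>carrier G. scale (h z) (?\<delta> z)) y = (\<Sum>z\<in>carrier G. if z = y then h y else 0)"
        unfolding sum_apply scale_def by (rule sum.cong) auto
      then show "h y = (\<Sum>z\<in>carrier G. scale (h z) (?\<delta> z)) y"
        using E0[OF h] fin by auto
    qed
    then show "h \<in> span (?\<delta> ` carrier G)"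
      by (metis (no_types, lifting) imageI span_base span_scale span_sum)
  qed
  then have "finite B"
    using independent_span_bound[of "?\<delta> ` carrier G" B] B fin by auto
  have "(\<lambda>y. if y \<in> carrier G then f y else 0) \<in> E"
    using eig by (auto simp: E_def cong: sum.cong)
  moreover have "(\<lambda>y. if y \<in> carrier G then f y else 0) \<noteq> 0"
    using nonzero by (auto simp: fun_eq_iff)
  ultimately have "B \<noteq> {}"
    using span_B by (metis singletonD span_empty)
  have ord: "Coset.order G > 0"
    using fin by (simp add: order_gt_0_iff_finite)
  have \<rho>_E: "\<rho> u h \<in> E" if u: "u \<in> carrier G" and h: "h \<in> E" for u h
  proof -
    have "(\<Sum>w\<in>carrier G. of_nat (d w) * h (u \<otimes> (w \<otimes> g))) = x * h (u \<otimes> g)"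
      if g: "g \<in> carrier G" for g
    proof -
      have "x * h (u \<otimes> g) = (\<Sum>w\<in>carrier G. of_nat (d w) * h (w \<otimes> (u \<otimes> g)))"
        using h u g by (simp add: E_def)
      \<comment> \<open>Replacing \<open>w\<close> by its conjugate moves \<open>u\<close> to the
        front of the argument of \<open>h\<close> without changing \<open>d\<close>.\<close>
      also have "\<dots> = (\<Sum>w\<in>carrier G. of_nat (d (u \<otimes> w \<otimes> inv u)) * h (u \<otimes> w \<otimes> inv u \<otimes> (u \<otimes> g)))"
        by (rule sum.reindex_bij_betw[OF bij_betw_conjugation[OF fin u], symmetric])
      also have "\<dots> = (\<Sum>w\<in>carrier G. of_nat (d w) * h (u \<otimes> (w \<otimes> g)))"
      proof (rule sum.cong)
        fix w assume w: "w \<in> carrier G"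
        have "u \<otimes> w \<otimes> inv u \<otimes> (u \<otimes> g) = u \<otimes> (w \<otimes> (inv u \<otimes> (u \<otimes> g)))"
          using u w g by (simp add: m_assoc)
        also have "inv u \<otimes> (u \<otimes> g) = g"
          using u g by (simp flip: m_assoc)
        finally show "of_nat (d (u \<otimes> w \<otimes> inv u)) * h (u \<otimes> w \<otimes> inv u \<otimes> (u \<otimes> g)) =
            of_nat (d w) * h (u \<otimes> (w \<otimes> g))"
          using d_conj[OF u w] by simp
      qed simp
      finally show ?thesis by simp
    qed
    then show ?thesis
      by (auto simp: E_def \<rho>_def cong: sum.cong)
  qed
  \<comment> \<open>For \<open>a = 0\<close> this depends on \<open>h\<close> vanishing off the
    group: \<open>\<rho> \<one>\<close> cuts functions off there, the identity does not.\<close>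
  have \<rho>_pow: "(\<rho> u ^^ a) h = \<rho> (u [^] a) h" if u: "u \<in> carrier G" and h: "h \<in> E" for u h a
  proof (induction a)
    case 0
    show ?case using E0[OF h] by (auto simp: \<rho>_def)
  next
    case (Suc a)
    then show ?case using u by (auto simp: \<rho>_def fun_eq_iff m_assoc)
  qed
  show ?thesis
  proof (rule Rats_of_power_invariant_combination
      [where scale = scale and B = B and I = "carrier G" and \<rho> = \<rho> and n = "Coset.order G"
         and p = "\<lambda>a g. g [^] a" and c = "\<lambda>g. of_nat (d g)"])
    show "Vector_Spaces.linear scale scale (\<rho> g)" for g
      by (rule linear_module_homI, unfold_locales) (auto simp: \<rho>_def scale_def fun_eq_iff)
    show "(\<rho> g ^^ Coset.order G) v = v" if "g \<in> carrier G" "v \<in> span B" for g v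
      using that E0 \<rho>_pow[of g v] by (auto simp: span_B pow_order_eq_1 \<rho>_def)
    show "(\<Sum>g\<in>carrier G. scale (of_nat (d g)) (\<rho> g v)) = scale x v" if "v \<in> span B" for v
    proof
      fix y
      have sum_apply: "(\<Sum>z\<in>A. k z) y = (\<Sum>z\<in>A. k z y)" for A :: "'a set" and k :: "'a \<Rightarrow> 'a \<Rightarrow> complex"
        by (induction A rule: infinite_finite_induct) auto
      show "(\<Sum>g\<in>carrier G. scale (of_nat (d g)) (\<rho> g v)) y = scale x v y"
        using that by (cases "y \<in> carrier G") (auto simp: span_B sum_apply scale_def \<rho>_def E_def)
    qed
  qed (use B \<open>finite B\<close> \<open>B \<noteq> {}\<close> ord fin \<rho>_E \<rho>_pow span_B d_pow in
      \<open>auto simp: totatives_def intro: bij_betw_pow_coprime vector_space_axioms\<close>)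
qed

section \<open>Counting modulo a prime with a cyclic action\<close>

text \<open>Every orbit has exactly \<open>p\<close> elements and \<open>w\<close> is constant on
  it, so it contributes a multiple of \<open>p\<close>. Removing one orbit leaves a smaller set with
  the same properties.\<close>

lemma prime_dvd_sum_free_action:
  fixes w :: "'a \<Rightarrow> nat"
  assumes p: "prime p" and "finite S"
    and "\<And>x. x \<in> S \<Longrightarrow> r x \<in> S"
    and "\<And>x. x \<in> S \<Longrightarrow> (r ^^ p) x = x"
    and "\<And>x. x \<in> S \<Longrightarrow> r x \<noteq> x"
    and "\<And>x. x \<in> S \<Longrightarrow> w (r x) = w x"
  shows "p dvd sum w S"
  using assms(2-)
proof (induction S rule: finite_psubset_induct)
  case (psubset S)
  show ?case
  proof (cases "S = {}")
    case False
    then obtain x where x: "x \<in> S" by auto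
    define X where "X = (\<lambda>i. (r ^^ i) x) ` {..<p}"
    have p0: "p > 0" using p by (simp add: prime_gt_0_nat)
    have in_S: "(r ^^ i) x \<in> S" for i
      by (induction i) (use x psubset.prems in auto)
    have w_X: "w ((r ^^ i) x) = w x" for i
      by (induction i) (use in_S psubset.prems in auto)
    have in_X: "(r ^^ i) x \<in> X" for i
    proof -
      have "(r ^^ i) x = (r ^^ (i mod p)) x"
        using psubset.prems(2)[OF x] by (simp add: funpow_mod_eq)
      then show ?thesis using p0 by (auto simp: X_def)
    qed
    \<comment> \<open>As \<open>d\<close> is invertible modulo \<open>p\<close>, returning after
      \<open>d\<close> steps would force \<open>r x = x\<close>.\<close>
    have no_return: "(r ^^ d) x \<noteq> x" if d: "0 < d" "d < p" for d
    proof
      assume ret: "(r ^^ d) x = x"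
      have "coprime d p"
        using d p by (metis coprime_commute nat_dvd_not_less prime_imp_coprime)
      then obtain a where a: "[d * a = Suc 0] (mod p)"
        using cong_solve_coprime_nat by blast
      have "(r ^^ (d * a)) x = (r ^^ (d * a mod d)) x"
        using ret by (simp only: funpow_mod_eq)
      then have "x = (r ^^ (d * a)) x"
        by simp
      also have "\<dots> = (r ^^ (d * a mod p)) x"
        using psubset.prems(2)[OF x] by (simp only: funpow_mod_eq)
      also have "d * a mod p = 1"
        using a prime_gt_1_nat[OF p] by (simp add: cong_def)
      finally show False
        using psubset.prems(3)[OF x] by simp
    qed
    have "inj_on (\<lambda>i. (r ^^ i) x) {..<p}"
    proof (rule linorder_inj_onI')
      fix i j assume ij: "i \<in> {..<p}" "j \<in> {..<p}" "i < j"
      show "(r ^^ i) x \<noteq> (r ^^ j) x"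
      proof
        assume "(r ^^ i) x = (r ^^ j) x"
        then have "(r ^^ (p - i)) ((r ^^ i) x) = (r ^^ (p - i)) ((r ^^ j) x)"
          by simp
        then have "(r ^^ (p - i + i)) x = (r ^^ (p - i + j)) x"
          by (simp only: funpow_add o_apply)
        moreover have "p - i + j = (j - i) + p"
          using ij by auto
        moreover have "(r ^^ (j - i + p)) x = (r ^^ (j - i)) ((r ^^ p) x)"
          by (simp only: funpow_add o_apply)
        ultimately have "(r ^^ p) x = (r ^^ (j - i)) ((r ^^ p) x)"
          using ij by simp
        moreover have "0 < j - i" "j - i < p"
          using ij by auto
        ultimately show False
          using psubset.prems(2)[OF x] no_return[of "j - i"] by simp
      qed
    qed
    then have card_X: "card X = p"
      by (simp add: X_def card_image)
    have X_S: "X \<subseteq> S" using in_S by (auto simp: X_def)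
    have "p dvd sum w (S - X)"
    proof (rule psubset.IH)
      show "S - X \<subset> S" using in_X[of 0] x by auto
      \<comment> \<open>If \<open>r y\<close> lay in the orbit \<open>X\<close>, so would
        \<open>y\<close>, because \<open>r ^^ (p - 1)\<close> undoes \<open>r\<close>.\<close>
      show "r y \<in> S - X" if y: "y \<in> S - X" for y
      proof -
        have "r y \<notin> X"
        proof
          assume "r y \<in> X"
          then obtain i where "r y = (r ^^ i) x" by (auto simp: X_def)
          then have "(r ^^ (p - 1)) (r y) = (r ^^ (p - 1 + i)) x"
            by (simp add: funpow_add)
          moreover have "(r ^^ Suc (p - 1)) y = (r ^^ (p - 1)) (r y)"
            by (simp only: funpow_Suc_right o_apply)
          then have "(r ^^ (p - 1)) (r y) = y"
            using psubset.prems(2)[of y] y p0 by simp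
          ultimately show False using y in_X by auto
        qed
        then show ?thesis using y psubset.prems by auto
      qed
    qed (use psubset.prems in auto)
    moreover have "sum w X = (\<Sum>y\<in>X. w x)"
      by (rule sum.cong) (use w_X in \<open>auto simp: X_def\<close>)
    moreover have "sum w S = sum w X + sum w (S - X)"
      using X_S psubset.hyps by (metis add.commute sum.subset_diff)
    ultimately show ?thesis by (simp add: card_X)
  qed simp
qed

lemma sum_fixed_points_cong:
  fixes w :: "'a \<Rightarrow> nat"
  assumes p: "prime p" and fin: "finite S"
    and S: "\<And>x. x \<in> S \<Longrightarrow> r x \<in> S"
    and pow: "\<And>x. x \<in> S \<Longrightarrow> (r ^^ p) x = x"
    and w: "\<And>x. x \<in> S \<Longrightarrow> w (r x) = w x"
  shows "[sum w S = sum w {x \<in> S. r x = x}] (mod p)"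
proof -
  \<comment> \<open>Points that are not fixed stay so: if \<open>r x\<close> were fixed, all later
    iterates would equal \<open>r x\<close>, but \<open>(r ^^ p) x\<close> is
    \<open>x\<close>.\<close>
  have "r (r x) \<noteq> r x" if x: "x \<in> S" "r x \<noteq> x" for x
  proof
    assume fixed: "r (r x) = r x"
    have "(r ^^ Suc i) x = r x" for i
      by (induction i) (simp_all add: fixed)
    from this[of "p - 1"] show False
      using pow[OF x(1)] x(2) prime_gt_0_nat[OF p] by simp
  qed
  then have "p dvd sum w {x \<in> S. r x \<noteq> x}"
    by (intro prime_dvd_sum_free_action[OF p, of _ r]) (use assms in auto)
  moreover have "sum w S = sum w {x \<in> S. r x = x} + sum w {x \<in> S. r x \<noteq> x}"
    by (subst sum.union_disjoint[symmetric]) (use fin in \<open>auto intro: sum.cong\<close>)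
  ultimately show ?thesis
    by (auto simp: cong_def elim!: dvdE)
qed

lemma fermat_power_cong:
  fixes p a :: nat
  assumes "prime p"
  shows "[a ^ p = a] (mod p)"
proof (cases "p dvd a")
  case True
  then show ?thesis
    using prime_gt_0_nat[OF assms] by (simp add: cong_def dvd_power_iff dvd_trans[OF _ dvd_power])
next
  case False
  then have "[a * a ^ (p - 1) = a * 1] (mod p)"
    using fermat_theorem[OF assms] by (intro cong_mult) auto
  then show ?thesis
    using prime_gt_0_nat[OF assms] by (simp add: power_eq_if)
qed

section \<open>Convolution powers of class functions\<close>

text \<open>The multiplicative monoid of the group semiring with natural coefficients. Demanding the
  value 0 off the group makes two elements equal as soon as they agree on it. The monoid structure
  provides the power laws for exchanging exponents.\<close>

definition convolution_monoid :: "('a, 'c) monoid_scheme \<Rightarrow> ('a \<Rightarrow> nat) monoid" where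
  "convolution_monoid G =
     \<lparr>carrier = {f. \<forall>x. x \<notin> carrier G \<longrightarrow> f x = 0},
      monoid.mult = (\<lambda>f g x. if x \<in> carrier G
        then \<Sum>y\<in>carrier G. f y * g (inv\<^bsub>G\<^esub> y \<otimes>\<^bsub>G\<^esub> x) else 0),
      one = (\<lambda>x. if x = \<one>\<^bsub>G\<^esub> then 1 else 0)\<rparr>"

definition mult_list :: "('a, 'c) monoid_scheme \<Rightarrow> 'a list \<Rightarrow> 'a" where
  "mult_list G xs = foldr (\<otimes>\<^bsub>G\<^esub>) xs \<one>\<^bsub>G\<^esub>"

context group
begin

abbreviation "M \<equiv> convolution_monoid G"

lemma mult_list_Nil [simp]: "mult_list G [] = \<one>"
  and mult_list_Cons [simp]: "mult_list G (x # xs) = x \<otimes> mult_list G xs"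
  by (simp_all add: mult_list_def)

lemma mult_list_closed [simp]: "set xs \<subseteq> carrier G \<Longrightarrow> mult_list G xs \<in> carrier G"
  by (induction xs) auto

lemma mult_list_append:
  "set xs \<subseteq> carrier G \<Longrightarrow> set ys \<subseteq> carrier G \<Longrightarrow>
     mult_list G (xs @ ys) = mult_list G xs \<otimes> mult_list G ys"
  by (induction xs) (auto simp: m_assoc)

lemma mult_list_replicate: "x \<in> carrier G \<Longrightarrow> mult_list G (replicate k x) = x [^] k"
proof (induction k)
  case (Suc k)
  then show ?case by (simp only: replicate_Suc mult_list_Cons nat_pow_Suc2)
qed simp

lemma bij_betw_left_mult:
  assumes "y \<in> carrier G"
  shows "bij_betw (\<lambda>x. y \<otimes> x) (carrier G) (carrier G)"
  by (rule bij_betwI[where g = "\<lambda>x. inv y \<otimes> x"])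
     (use assms in \<open>auto simp flip: m_assoc\<close>)

lemma convolution_monoid:
  assumes fin: "finite (carrier G)"
  shows "Group.monoid M"
proof (rule monoidI)
  fix f g h assume f: "f \<in> carrier M" and g: "g \<in> carrier M" and h: "h \<in> carrier M"
  show "f \<otimes>\<^bsub>M\<^esub> g \<otimes>\<^bsub>M\<^esub> h = f \<otimes>\<^bsub>M\<^esub> (g \<otimes>\<^bsub>M\<^esub> h)"
  proof
    fix x
    show "(f \<otimes>\<^bsub>M\<^esub> g \<otimes>\<^bsub>M\<^esub> h) x = (f \<otimes>\<^bsub>M\<^esub> (g \<otimes>\<^bsub>M\<^esub> h)) x"
    proof (cases "x \<in> carrier G")
      case x: True
      have "(f \<otimes>\<^bsub>M\<^esub> g \<otimes>\<^bsub>M\<^esub> h) x =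
          (\<Sum>z\<in>carrier G. \<Sum>y\<in>carrier G. f y * (g (inv y \<otimes> z) * h (inv z \<otimes> x)))"
        using x by (simp add: convolution_monoid_def sum_distrib_right mult.assoc cong: sum.cong)
      also have "\<dots> = (\<Sum>y\<in>carrier G. \<Sum>z\<in>carrier G. f y * (g (inv y \<otimes> z) * h (inv z \<otimes> x)))"
        by (rule sum.swap)
      \<comment> \<open>Substitute \<open>z = y \<otimes> u\<close> in the inner sum.\<close>
      also have "\<dots> = (\<Sum>y\<in>carrier G. \<Sum>u\<in>carrier G. f y * (g u * h (inv u \<otimes> (inv y \<otimes> x))))"
      proof (rule sum.cong)
        fix y assume y: "y \<in> carrier G"
        have "(\<Sum>z\<in>carrier G. f y * (g (inv y \<otimes> z) * h (inv z \<otimes> x))) =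
            (\<Sum>u\<in>carrier G. f y * (g (inv y \<otimes> (y \<otimes> u)) * h (inv (y \<otimes> u) \<otimes> x)))"
          by (rule sum.reindex_bij_betw[OF bij_betw_left_mult[OF y], symmetric])
        also have "\<dots> = (\<Sum>u\<in>carrier G. f y * (g u * h (inv u \<otimes> (inv y \<otimes> x))))"
        proof (rule sum.cong)
          fix u assume u: "u \<in> carrier G"
          have "inv y \<otimes> (y \<otimes> u) = u"
            using y u by (simp flip: m_assoc)
          moreover have "inv (y \<otimes> u) \<otimes> x = inv u \<otimes> (inv y \<otimes> x)"
            using x y u by (simp add: inv_mult_group m_assoc)
          ultimately show "f y * (g (inv y \<otimes> (y \<otimes> u)) * h (inv (y \<otimes> u) \<otimes> x)) =
              f y * (g u * h (inv u \<otimes> (inv y \<otimes> x)))" by simp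
        qed simp
        finally show "(\<Sum>z\<in>carrier G. f y * (g (inv y \<otimes> z) * h (inv z \<otimes> x))) =
            (\<Sum>u\<in>carrier G. f y * (g u * h (inv u \<otimes> (inv y \<otimes> x))))" .
      qed simp
      also have "\<dots> = (f \<otimes>\<^bsub>M\<^esub> (g \<otimes>\<^bsub>M\<^esub> h)) x"
        using x by (simp add: convolution_monoid_def sum_distrib_left cong: sum.cong)
      finally show ?thesis .
    qed (simp add: convolution_monoid_def)
  qed
next
  fix f assume f: "f \<in> carrier M"
  show "\<one>\<^bsub>M\<^esub> \<otimes>\<^bsub>M\<^esub> f = f"
  proof
    fix x
    have "(\<Sum>y\<in>carrier G. (if y = \<one> then 1 else 0) * f (inv y \<otimes> x)) =
        (\<Sum>y\<in>carrier G. if y = \<one> then f (inv \<one> \<otimes> x) else 0)"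
      by (rule sum.cong) auto
    then show "(\<one>\<^bsub>M\<^esub> \<otimes>\<^bsub>M\<^esub> f) x = f x"
      using f fin by (auto simp: convolution_monoid_def)
  qed
  show "f \<otimes>\<^bsub>M\<^esub> \<one>\<^bsub>M\<^esub> = f"
  proof
    fix x
    have "(\<Sum>y\<in>carrier G. f y * (if inv y \<otimes> x = \<one> then 1 else 0)) =
        (\<Sum>y\<in>carrier G. if y = x then f x else 0)" if x: "x \<in> carrier G"
    proof (rule sum.cong)
      fix y assume y: "y \<in> carrier G"
      have "inv y \<otimes> x = \<one> \<longleftrightarrow> y = x"
        using x y by (metis inv_solve_left r_one one_closed)
      then show "f y * (if inv y \<otimes> x = \<one> then 1 else 0) = (if y = x then f x else 0)"
        by simp
    qed simp
    then show "(f \<otimes>\<^bsub>M\<^esub> \<one>\<^bsub>M\<^esub>) x = f x"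
      using f fin by (auto simp: convolution_monoid_def)
  qed
qed (auto simp: convolution_monoid_def)

lemma convolution_pow_Suc:
  assumes "x \<in> carrier G"
  shows "(f [^]\<^bsub>M\<^esub> Suc k) x = (\<Sum>y\<in>carrier G. (f [^]\<^bsub>M\<^esub> k) y * f (inv y \<otimes> x))"
  using assms by (simp add: nat_pow_def) (simp add: convolution_monoid_def)

text \<open>This serves to replace the \<open>p\<close>-th convolution power of an indicator
  function by the function itself inside a further power.\<close>

lemma convolution_pow_cong:
  assumes "\<And>x. x \<in> carrier G \<Longrightarrow> [f x = g x] (mod p)"
  shows "x \<in> carrier G \<Longrightarrow> [(f [^]\<^bsub>M\<^esub> (k::nat)) x = (g [^]\<^bsub>M\<^esub> k) x] (mod p)"
proof (induction k arbitrary: x)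
  case 0
  show ?case by (simp add: nat_pow_def)
next
  case (Suc k)
  then show ?case
    unfolding convolution_pow_Suc[OF Suc.prems] by (intro cong_sum cong_mult assms) auto
qed

text \<open>Conjugation by \<open>w\<close> permutes the summation variable and respects the
  quotient \<open>inv y \<otimes> x\<close>, so invariance passes through each convolution.\<close>

lemma convolution_pow_class_function:
  assumes fin: "finite (carrier G)"
    and f: "\<And>w x. w \<in> carrier G \<Longrightarrow> x \<in> carrier G \<Longrightarrow> f (w \<otimes> x \<otimes> inv w) = f x"
    and w: "w \<in> carrier G"
  shows "x \<in> carrier G \<Longrightarrow> (f [^]\<^bsub>M\<^esub> (k::nat)) (w \<otimes> x \<otimes> inv w) = (f [^]\<^bsub>M\<^esub> k) x"
proof (induction k arbitrary: x)
  case 0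
  have "w \<otimes> x \<otimes> inv w = \<one> \<longleftrightarrow> x = \<one>"
    using w 0 by (metis inv_closed inv_solve_right l_one m_closed one_closed r_one l_cancel_one)
  then show ?case by (simp add: nat_pow_def convolution_monoid_def)
next
  case (Suc k)
  let ?c = "\<lambda>y. w \<otimes> y \<otimes> inv w"
  have "(f [^]\<^bsub>M\<^esub> Suc k) (?c x) = (\<Sum>y\<in>carrier G. (f [^]\<^bsub>M\<^esub> k) y * f (inv y \<otimes> ?c x))"
    using w Suc.prems by (simp only: convolution_pow_Suc m_closed inv_closed)
  also have "\<dots> = (\<Sum>y\<in>carrier G. (f [^]\<^bsub>M\<^esub> k) (?c y) * f (inv (?c y) \<otimes> ?c x))"
    by (rule sum.reindex_bij_betw[OF bij_betw_conjugation[OF fin w], symmetric])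
  also have "\<dots> = (\<Sum>y\<in>carrier G. (f [^]\<^bsub>M\<^esub> k) y * f (inv y \<otimes> x))"
  proof (rule sum.cong)
    fix y assume y: "y \<in> carrier G"
    have "inv (?c y) \<otimes> ?c x = w \<otimes> (inv y \<otimes> (inv w \<otimes> (w \<otimes> (x \<otimes> inv w))))"
      using w y Suc.prems by (simp add: inv_mult_group m_assoc)
    also have "inv w \<otimes> (w \<otimes> (x \<otimes> inv w)) = x \<otimes> inv w"
      using w Suc.prems by (simp flip: m_assoc)
    finally have "inv (?c y) \<otimes> ?c x = ?c (inv y \<otimes> x)"
      using w y Suc.prems by (simp add: m_assoc)
    then show "(f [^]\<^bsub>M\<^esub> k) (?c y) * f (inv (?c y) \<otimes> ?c x) = (f [^]\<^bsub>M\<^esub> k) y * f (inv y \<otimes> x)"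
      using Suc.IH[OF y] f[OF w] y Suc.prems by simp
  qed simp
  also have "\<dots> = (f [^]\<^bsub>M\<^esub> Suc k) x"
    using Suc.prems by (simp only: convolution_pow_Suc)
  finally show ?case .
qed

section \<open>Convolution powers as weighted counts of factorizations\<close>

definition factorizations :: "nat \<Rightarrow> 'a \<Rightarrow> 'a list set" where
  "factorizations k x = {xs. set xs \<subseteq> carrier G \<and> length xs = k \<and> mult_list G xs = x}"

lemma finite_factorizations: "finite (carrier G) \<Longrightarrow> finite (factorizations k x)"
  by (rule finite_subset[OF _ finite_lists_length_eq[of "carrier G" k]])
     (auto simp: factorizations_def)

lemma convolution_pow_eq_sum:
  assumes fin: "finite (carrier G)" and f: "f \<in> carrier M"
  shows "x \<in> carrier G \<Longrightarrow>
    (f [^]\<^bsub>M\<^esub> k) x = (\<Sum>xs\<in>factorizations k x. prod_list (map f xs))"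
proof (induction k arbitrary: x)
  case 0
  have "factorizations 0 x = (if x = \<one> then {[]} else {})"
    by (auto simp: factorizations_def)
  then show ?case by (simp add: nat_pow_def convolution_monoid_def)
next
  case (Suc k)
  interpret M: Group.monoid M by (rule convolution_monoid[OF fin])
  \<comment> \<open>The power is defined by multiplying on the right; splitting off the first factor
    instead matches \<open>y # xs\<close>.\<close>
  have "(f [^]\<^bsub>M\<^esub> Suc k) x = (f \<otimes>\<^bsub>M\<^esub> f [^]\<^bsub>M\<^esub> k) x"
    by (simp only: M.nat_pow_Suc2[OF f])
  also have "\<dots> = (\<Sum>y\<in>carrier G. f y * (f [^]\<^bsub>M\<^esub> k) (inv y \<otimes> x))"
    using Suc.prems by (simp add: convolution_monoid_def)
  also have "\<dots> = (\<Sum>y\<in>carrier G. \<Sum>xs\<in>factorizations k (inv y \<otimes> x). prod_list (map f (y # xs)))"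
    using Suc by (simp add: sum_distrib_left)
  also have "\<dots> = (\<Sum>(y, xs)\<in>(SIGMA y:carrier G. factorizations k (inv y \<otimes> x)).
      prod_list (map f (y # xs)))"
    by (rule sum.Sigma) (auto simp: fin finite_factorizations)
  also have "\<dots> = (\<Sum>xs\<in>factorizations (Suc k) x. prod_list (map f xs))"
  proof (rule sum.reindex_bij_witness[of _ "\<lambda>xs. (hd xs, tl xs)" "\<lambda>(y, xs). y # xs"])
    fix xs assume "xs \<in> factorizations (Suc k) x"
    then obtain y ys where xs: "xs = y # ys" "y \<in> carrier G" "set ys \<subseteq> carrier G" "length ys = k"
        "x = y \<otimes> mult_list G ys"
      by (cases xs) (auto simp: factorizations_def)
    then have "inv y \<otimes> x = mult_list G ys"
      by (simp flip: m_assoc)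
    then show "(hd xs, tl xs) \<in> (SIGMA y:carrier G. factorizations k (inv y \<otimes> x))"
      using xs by (simp add: factorizations_def)
    show "(case (hd xs, tl xs) of (y, xs) \<Rightarrow> y # xs) = xs"
      using xs by simp
  next
    fix z assume z: "z \<in> (SIGMA y:carrier G. factorizations k (inv y \<otimes> x))"
    obtain y ys where zy: "z = (y, ys)" by force
    have "y \<otimes> (inv y \<otimes> x) = x"
      using z Suc.prems by (simp add: zy flip: m_assoc)
    then show "(case z of (y, xs) \<Rightarrow> y # xs) \<in> factorizations (Suc k) x"
      using z by (auto simp: zy factorizations_def)
  qed (auto simp: factorizations_def)
  finally show ?case .
qed

lemma conj_pow:
  assumes "w \<in> carrier G" "x \<in> carrier G"
  shows "(w \<otimes> x \<otimes> inv w) [^] (k::nat) = w \<otimes> x [^] k \<otimes> inv w"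
proof (induction k)
  case (Suc k)
  have "w \<otimes> x [^] k \<otimes> inv w \<otimes> (w \<otimes> x \<otimes> inv w) = w \<otimes> (x [^] k \<otimes> (inv w \<otimes> (w \<otimes> (x \<otimes> inv w))))"
    using assms by (simp add: m_assoc)
  also have "inv w \<otimes> (w \<otimes> (x \<otimes> inv w)) = x \<otimes> inv w"
    using assms by (simp flip: m_assoc)
  finally show ?case
    using Suc assms by (simp add: m_assoc)
qed (use assms in simp)

text \<open>Count factorizations of length \<open>p\<close> over the whole class of
  \<open>h [^] p\<close>, because rotating a list conjugates its product. Modulo \<open>p\<close>
  only constant lists survive, giving \<open>card (cls h) * f h ^ p\<close>. Since \<open>p\<close>
  exceeds the group order, the class size cancels, and Fermat's theorem removes the
  exponent.\<close>

lemma convolution_pow_prime_cong: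
  assumes fin: "finite (carrier G)" and fM: "f \<in> carrier M"
    and f: "\<And>w x. w \<in> carrier G \<Longrightarrow> x \<in> carrier G \<Longrightarrow> f (w \<otimes> x \<otimes> inv w) = f x"
    and p: "prime p" "p > Coset.order G" and h: "h \<in> carrier G"
  shows "[(f [^]\<^bsub>M\<^esub> p) (h [^] p) = f h] (mod p)"
proof -
  have p0: "p > 0" using p by simp
  have ord: "Coset.order G > 0"
    using fin by (simp add: order_gt_0_iff_finite)
  have cop: "coprime p (Coset.order G)"
    using p ord by (metis nat_dvd_not_less prime_imp_coprime)
  have pow_inj: "inj_on (\<lambda>x. x [^] p) (carrier G)"
    using bij_betw_pow_coprime[OF fin cop] by (simp add: bij_betw_def)
  define cls where "cls x = (\<lambda>w. w \<otimes> x \<otimes> inv w) ` carrier G" for x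
  have cls_closed: "cls x \<subseteq> carrier G" if "x \<in> carrier G" for x
    using that by (auto simp: cls_def)
  have cls_pow: "cls (h [^] p) = (\<lambda>x. x [^] p) ` cls h"
    using h by (simp add: cls_def image_image conj_pow)
  then have card_cls: "card (cls (h [^] p)) = card (cls h)"
    using inj_on_subset[OF pow_inj cls_closed[OF h]] by (simp add: card_image)
  define S where "S = (\<Union>c\<in>cls (h [^] p). factorizations p c)"
  have S_iff: "xs \<in> S \<longleftrightarrow> set xs \<subseteq> carrier G \<and> length xs = p \<and> mult_list G xs \<in> cls (h [^] p)" for xs
    by (auto simp: S_def factorizations_def)
  have "finite S"
    using fin by (auto simp: S_def cls_def finite_factorizations)
  let ?w = "\<lambda>xs. prod_list (map f xs)"
  \<comment> \<open>Rotation conjugates the product of a list, so it acts on the lists with product in a given class.\<close>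
  have "[sum ?w S = sum ?w {xs \<in> S. rotate1 xs = xs}] (mod p)"
  proof (rule sum_fixed_points_cong[OF p(1) \<open>finite S\<close>])
    fix xs assume xs: "xs \<in> S"
    show "(rotate1 ^^ p) xs = xs"
      using xs by (simp add: S_iff flip: rotate_def)
    obtain y ys where ys: "xs = y # ys"
      using xs p0 by (cases xs) (auto simp: S_iff)
    then have y: "y \<in> carrier G" "set ys \<subseteq> carrier G"
      using xs by (auto simp: S_iff)
    show "?w (rotate1 xs) = ?w xs"
      by (simp add: ys)
    obtain w where w: "w \<in> carrier G" "y \<otimes> mult_list G ys = w \<otimes> h [^] p \<otimes> inv w"
      using xs by (auto simp: S_iff ys cls_def)
    have "mult_list G (rotate1 xs) = mult_list G ys \<otimes> y"
      using y by (simp add: ys mult_list_append)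
    also have "\<dots> = inv y \<otimes> (y \<otimes> mult_list G ys) \<otimes> y"
      using y by (simp flip: m_assoc)
    also have "\<dots> = (inv y \<otimes> w) \<otimes> h [^] p \<otimes> inv (inv y \<otimes> w)"
      using y w h by (simp add: inv_mult_group m_assoc)
    finally show "rotate1 xs \<in> S"
      using xs y w by (auto simp: S_iff cls_def)
  qed
  \<comment> \<open>A list fixed by rotation is constant, say \<open>replicate p g\<close>, with
    product \<open>g [^] p\<close>. By injectivity of the \<open>p\<close>-th power map, the product
    lies in the class of \<open>h [^] p\<close> exactly if \<open>g\<close> lies in that of
    \<open>h\<close>.\<close>
  also have "{xs \<in> S. rotate1 xs = xs} = replicate p ` cls h"
  proof (intro equalityI subsetI)
    fix xs assume "xs \<in> {xs \<in> S. rotate1 xs = xs}"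
    then have xs: "xs \<in> S" "rotate1 xs = xs" by auto
    have "xs \<noteq> []" using xs p0 by (auto simp: S_iff)
    then obtain g where "set xs = {g}"
      using rotate1_fixpoint_card[OF xs(2)] by (auto simp: card_1_singleton_iff)
    then have xs_eq: "xs = replicate p g" and g: "g \<in> carrier G"
      using xs by (auto simp: S_iff intro: replicate_eqI)
    have "g [^] p \<in> (\<lambda>x. x [^] p) ` cls h"
      using xs g by (simp add: S_iff xs_eq mult_list_replicate cls_pow)
    then have "g \<in> cls h"
      using inj_on_image_mem_iff[OF pow_inj g cls_closed[OF h]] by simp
    then show "xs \<in> replicate p ` cls h" unfolding xs_eq by (rule imageI)
  next
    fix xs assume "xs \<in> replicate p ` cls h"
    then obtain g where g: "xs = replicate p g" "g \<in> cls h" by auto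
    then have "g \<in> carrier G" using cls_closed[OF h] by auto
    then show "xs \<in> {xs \<in> S. rotate1 xs = xs}"
      using g p0 by (auto simp: S_iff mult_list_replicate cls_pow rotate1_replicate)
  qed
  also have "sum ?w (replicate p ` cls h) = (\<Sum>g\<in>cls h. f g ^ p)"
    using p0 by (subst sum.reindex) (auto simp: inj_on_def prod_list_replicate)
  also have "\<dots> = card (cls h) * f h ^ p"
  proof -
    have "f g = f h" if "g \<in> cls h" for g
      using that f h by (auto simp: cls_def)
    then show ?thesis by simp
  qed
  also have "sum ?w S = card (cls h) * (f [^]\<^bsub>M\<^esub> p) (h [^] p)"
  proof -
    have "sum ?w S = (\<Sum>c\<in>cls (h [^] p). \<Sum>xs\<in>factorizations p c. ?w xs)"
      unfolding S_def
      by (rule sum.UNION_disjoint) (auto simp: cls_def fin finite_factorizations, auto simp: factorizations_def)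
    also have "\<dots> = (\<Sum>c\<in>cls (h [^] p). (f [^]\<^bsub>M\<^esub> p) (h [^] p))"
    proof (rule sum.cong)
      fix c assume c: "c \<in> cls (h [^] p)"
      then have "c \<in> carrier G" using cls_closed[of "h [^] p"] h by auto
      moreover have "(f [^]\<^bsub>M\<^esub> p) c = (f [^]\<^bsub>M\<^esub> p) (h [^] p)"
        using c h convolution_pow_class_function[OF fin f, of _ "h [^] p" p] by (auto simp: cls_def)
      ultimately show "(\<Sum>xs\<in>factorizations p c. ?w xs) = (f [^]\<^bsub>M\<^esub> p) (h [^] p)"
        using convolution_pow_eq_sum[OF fin fM] by simp
    qed simp
    finally show ?thesis by (simp add: card_cls)
  qed
  finally have cong: "[card (cls h) * (f [^]\<^bsub>M\<^esub> p) (h [^] p) = card (cls h) * f h ^ p] (mod p)" .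
  have "card (cls h) \<le> Coset.order G" "card (cls h) > 0"
    using fin by (auto simp: cls_def Coset.order_def card_gt_0_iff intro!: card_image_le)
  then have "coprime (card (cls h)) p"
    using p by (metis coprime_commute leD nat_dvd_not_less order.strict_trans1 prime_imp_coprime)
  then have "[(f [^]\<^bsub>M\<^esub> p) (h [^] p) = f h ^ p] (mod p)"
    using cong by (simp add: cong_mult_lcancel_nat)
  then show ?thesis
    using fermat_power_cong[OF p(1)] cong_trans by blast
qed

section \<open>Factorizations of coprime powers\<close>

text \<open>The \<open>k\<close>-th convolution power \<open>y\<close> of the indicator function of
  \<open>T\<close> counts factorizations, and \<open>y (h [^] p)\<close> is congruent to
  \<open>y h\<close> modulo \<open>p\<close>. Once \<open>p\<close> exceeds all values of
  \<open>y\<close>, a positive count cannot vanish modulo \<open>p\<close>.\<close>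

lemma factorization_pow_large_prime:
  assumes fin: "finite (carrier G)" and T: "T \<subseteq> carrier G"
    and T_conj: "\<And>w t. w \<in> carrier G \<Longrightarrow> t \<in> T \<Longrightarrow> w \<otimes> t \<otimes> inv w \<in> T"
    and T_pow: "\<And>a t. coprime a (Coset.order G) \<Longrightarrow> t \<in> T \<Longrightarrow> t [^] (a::nat) \<in> T"
  shows "\<exists>N::nat. \<forall>p>N. prime p \<longrightarrow>
    (\<forall>h. (\<exists>xs. set xs \<subseteq> T \<and> length xs = k \<and> mult_list G xs = h) \<longrightarrow>
         (\<exists>xs. set xs \<subseteq> T \<and> length xs = k \<and> mult_list G xs = h [^] p))"
proof -
  interpret M: Group.monoid M by (rule convolution_monoid[OF fin])
  define f where "f x = (if x \<in> T then 1 else 0 :: nat)" for x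
  have fM: "f \<in> carrier M"
    using T by (auto simp: f_def convolution_monoid_def)
  have f_conj: "f (w \<otimes> x \<otimes> inv w) = f x" if "w \<in> carrier G" "x \<in> carrier G" for w x
  proof -
    have "inv w \<otimes> (w \<otimes> x \<otimes> inv w) \<otimes> inv (inv w) = (inv w \<otimes> w) \<otimes> x \<otimes> (inv w \<otimes> w)"
      using that by (simp only: m_assoc inv_inv m_closed inv_closed)
    then have "inv w \<otimes> (w \<otimes> x \<otimes> inv w) \<otimes> inv (inv w) = x"
      using that by simp
    then show ?thesis
      using T_conj[of w x] T_conj[of "inv w" "w \<otimes> x \<otimes> inv w"] that by (auto simp: f_def)
  qed
  define y where "y = f [^]\<^bsub>M\<^esub> k"
  have yM: "y \<in> carrier M"
    using fM by (simp add: y_def)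
  have y_conj: "y (w \<otimes> x \<otimes> inv w) = y x" if "w \<in> carrier G" "x \<in> carrier G" for w x
    unfolding y_def using convolution_pow_class_function[OF fin f_conj that] .
  have y_pos: "y h > 0 \<longleftrightarrow> (\<exists>xs. set xs \<subseteq> T \<and> length xs = k \<and> mult_list G xs = h)"
    if "h \<in> carrier G" for h
  proof -
    have f_pos: "prod_list (map f xs) > 0 \<longleftrightarrow> set xs \<subseteq> T" for xs
      by (induction xs) (auto simp: f_def)
    have "y h > 0 \<longleftrightarrow> (\<exists>xs\<in>factorizations k h. prod_list (map f xs) > 0)"
      unfolding y_def convolution_pow_eq_sum[OF fin fM that]
      using finite_factorizations[OF fin] by (auto simp: sum_eq_0_iff simp flip: neq0_conv)
    then show ?thesis
      using T by (fastforce simp: f_pos factorizations_def)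
  qed
  \<comment> \<open>The first summand makes \<open>p\<close> larger than the group order, the second
    larger than every value of \<open>y\<close>.\<close>
  define N where "N = Coset.order G + (\<Sum>x\<in>carrier G. y x)"
  show ?thesis
  proof (intro exI[of _ N] allI impI)
    fix p h assume p: "p > N" "prime p"
      and ex: "\<exists>xs. set xs \<subseteq> T \<and> length xs = k \<and> mult_list G xs = h"
    have h: "h \<in> carrier G"
      using ex T mult_list_closed by blast
    have p_ord: "p > Coset.order G" using p by (simp add: N_def)
    have cop: "coprime p (Coset.order G)"
      using p p_ord fin order_gt_0_iff_finite by (metis nat_dvd_not_less prime_imp_coprime)
    have f_pow: "f (x [^] p) = f x" if "x \<in> carrier G" for x
    proof -
      obtain b :: nat where b: "coprime b (Coset.order G)"
          "\<And>x. x \<in> carrier G \<Longrightarrow> (x [^] p) [^] b = x"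
        using coprime_power_inverse[OF fin cop] by blast
      have "x [^] p \<in> T \<longleftrightarrow> x \<in> T"
        using T_pow[OF b(1), of "x [^] p"] T_pow[OF cop, of x] b(2)[OF that] by metis
      then show ?thesis by (simp add: f_def)
    qed
    \<comment> \<open>Every \<open>x\<close> is a \<open>p\<close>-th power \<open>z [^] p\<close>
      with \<open>f z = f x\<close>, so the congruence for \<open>z\<close> is one at
      \<open>x\<close> itself.\<close>
    have "[(f [^]\<^bsub>M\<^esub> p) x = f x] (mod p)" if "x \<in> carrier G" for x
    proof -
      have "x \<in> (\<lambda>x. x [^] p) ` carrier G"
        using bij_betw_pow_coprime[OF fin cop] that by (simp add: bij_betw_def)
      then obtain z where z: "z \<in> carrier G" "x = z [^] p" by blast
      show ?thesis unfolding z(2)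
        using convolution_pow_prime_cong[OF fin fM f_conj p(2) p_ord z(1)] f_pow[OF z(1)] by simp
    qed
    then have "[((f [^]\<^bsub>M\<^esub> p) [^]\<^bsub>M\<^esub> k) (h [^] p) = y (h [^] p)] (mod p)"
      unfolding y_def using h by (intro convolution_pow_cong) auto
    \<comment> \<open>The two congruences come from raising \<open>f\<close> to the powers \<open>p\<close> and \<open>k\<close> in either order.\<close>
    moreover have "(f [^]\<^bsub>M\<^esub> p) [^]\<^bsub>M\<^esub> k = y [^]\<^bsub>M\<^esub> p"
      using fM by (simp add: y_def M.nat_pow_pow mult.commute)
    moreover have "[(y [^]\<^bsub>M\<^esub> p) (h [^] p) = y h] (mod p)"
      by (rule convolution_pow_prime_cong[OF fin yM y_conj p(2) p_ord h])
    ultimately have "[y (h [^] p) = y h] (mod p)"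
      by (metis cong_sym cong_trans)
    moreover have "y h > 0"
      using y_pos[OF h] ex by simp
    moreover have "y h < p"
      using member_le_sum[OF h, of y] fin p by (simp add: N_def)
    ultimately have "y (h [^] p) > 0"
      by (metis cong_def mod_0 mod_less neq0_conv)
    then show "\<exists>xs. set xs \<subseteq> T \<and> length xs = k \<and> mult_list G xs = h [^] p"
      using y_pos h by simp
  qed
qed

text \<open>The bound \<open>N\<close> depends on \<open>k\<close> but not on \<open>h\<close>, so
  the statement for large primes can be iterated along the prime factors of an exponent.\<close>

lemma factorization_pow_coprime:
  assumes fin: "finite (carrier G)" and T: "T \<subseteq> carrier G"
    and T_conj: "\<And>w t. w \<in> carrier G \<Longrightarrow> t \<in> T \<Longrightarrow> w \<otimes> t \<otimes> inv w \<in> T"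
    and T_pow: "\<And>a t. coprime a (Coset.order G) \<Longrightarrow> t \<in> T \<Longrightarrow> t [^] (a::nat) \<in> T"
    and a: "coprime a (Coset.order G)"
    and ex: "\<exists>xs. set xs \<subseteq> T \<and> length xs = k \<and> mult_list G xs = h"
  shows "\<exists>xs. set xs \<subseteq> T \<and> length xs = k \<and> mult_list G xs = h [^] (a::nat)"
proof -
  let ?P = "\<lambda>h. \<exists>xs. set xs \<subseteq> T \<and> length xs = k \<and> mult_list G xs = h"
  have closed: "h \<in> carrier G" if "?P h" for h
    using that T mult_list_closed by blast
  have ord: "Coset.order G > 0"
    using fin by (simp add: order_gt_0_iff_finite)
  obtain N :: nat where N: "\<And>p h. prime p \<Longrightarrow> p > N \<Longrightarrow> ?P h \<Longrightarrow> ?P (h [^] p)"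
    using factorization_pow_large_prime[OF fin T T_conj T_pow, of k] by blast
  \<comment> \<open>The disjunct \<open>b = 0\<close> absorbs the zero case of the induction over
    prime divisors.\<close>
  have large: "b = 0 \<or> (\<forall>h. ?P h \<longrightarrow> ?P (h [^] b))" if "\<And>q. prime q \<Longrightarrow> q dvd b \<Longrightarrow> q > N" for b :: nat
    using that
  proof (induction b rule: prime_divisors_induct)
    case (unit b)
    then show ?case using closed by (auto simp: nat_pow_eone)
  next
    case (factor p b)
    have "p > N" using factor.prems factor.hyps by simp
    have IH: "b = 0 \<or> (\<forall>h. ?P h \<longrightarrow> ?P (h [^] b))"
      using factor.IH factor.prems by simp
    show ?case
    proof (cases "b = 0")
      case False
      have "?P (h [^] (p * b))" if "?P h" for h
      proof -
        have "?P ((h [^] p) [^] b)"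
          using IH False N[OF factor.hyps \<open>p > N\<close> that] by blast
        then show ?thesis using closed[OF that] by (simp only: nat_pow_pow)
      qed
      then show ?thesis by blast
    qed simp
  qed simp
  \<comment> \<open>Replace \<open>a\<close> by a number in the same residue class all of whose prime factors exceed \<open>N\<close>.\<close>
  define m where "m = \<Prod>{q. prime q \<and> q \<le> N \<and> \<not> q dvd a}"
  define b where "b = a + Coset.order G * m"
  have fin_q: "finite {q. prime q \<and> q \<le> N \<and> \<not> q dvd a}" by simp
  have m_pos: "m > 0"
    unfolding m_def by (rule prod_pos) (auto simp: prime_gt_0_nat)
  \<comment> \<open>Let \<open>q \<le> N\<close>. If \<open>q\<close> divides \<open>a\<close>, it
    divides neither the order, by coprimality, nor \<open>m\<close>, hence not \<open>b\<close>.
    Otherwise \<open>q\<close> divides \<open>m\<close>, and dividing \<open>b\<close> would force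
    it to divide \<open>a\<close>.\<close>
  have "q > N" if q: "prime q" "q dvd b" for q
  proof (rule ccontr)
    assume "\<not> q > N"
    show False
    proof (cases "q dvd a")
      case True
      then have "q dvd Coset.order G * m"
        using q by (simp add: b_def dvd_add_right_iff)
      moreover have "\<not> q dvd Coset.order G"
        using a True q(1) by (metis coprime_common_divisor not_prime_unit)
      ultimately have "q dvd m" using q(1) prime_dvd_mult_iff by blast
      then obtain r where "prime r" "\<not> r dvd a" "q dvd r"
        using q(1) prime_dvd_prod_iff[OF fin_q q(1), of "\<lambda>q. q"] by (auto simp: m_def)
      then show False using True q(1) primes_dvd_imp_eq by blast
    next
      case False
      then have "q dvd m"
        unfolding m_def using q \<open>\<not> q > N\<close> by (intro dvd_prodI[OF fin_q]) auto
      then have "q dvd a" using q(2) by (simp add: b_def dvd_add_left_iff)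
      then show False using False by simp
    qed
  qed
  moreover have "b \<noteq> 0" using ord m_pos by (simp add: b_def)
  ultimately have "?P (h [^] b)" using large ex by blast
  moreover have "h [^] b = h [^] a"
    using closed[OF ex] by (intro nat_pow_cong[OF fin]) (auto simp: b_def cong_def)
  ultimately show ?thesis by simp
qed

end

section \<open>Cayley graphs\<close>

text \<open>Meant for lengths of paths (\<open>P\<close>) and of walks (\<open>Q\<close>): a path is
  a walk, and a walk can be shortened to a path.\<close>

lemma Least_eq_if_dominated:
  fixes P Q :: "nat \<Rightarrow> bool"
  assumes "\<And>k. P k \<Longrightarrow> Q k" "\<And>k. Q k \<Longrightarrow> \<exists>j\<le>k. P j"
  shows "Least P = Least Q"
proof (cases "\<exists>k. Q k")
  case True
  then have "Q (Least Q)" by (metis LeastI)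
  then obtain j where j: "j \<le> Least Q" "P j" using assms(2) by blast
  then have "j = Least Q" using assms(1) by (meson Least_le antisym)
  then show ?thesis
    using j assms(1) by (metis Least_equality Least_le)
next
  case False
  \<comment> \<open>Neither predicate holds anywhere, so both sides are the same unspecified
    value.\<close>
  then have "P = Q" using assms(1) by blast
  then show ?thesis by simp
qed

context group
begin

text \<open>Unspecified for elements that are not products of elements of \<open>T\<close>, like the graph distance.\<close>

definition word_length :: "'a set \<Rightarrow> 'a \<Rightarrow> nat" where
  "word_length T g = (LEAST k. \<exists>xs. set xs \<subseteq> T \<and> length xs = k \<and> mult_list G xs = g)"

text \<open>A walk of length \<open>k\<close> from \<open>u\<close> to \<open>v\<close> amounts to a
  list of \<open>k\<close> elements of \<open>T\<close> with product
  \<open>v \<otimes> inv u\<close>. If there is none, both sides are the same unspecified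
  number.\<close>

lemma graph_distance_cayley_graph:
  assumes T: "T \<subseteq> carrier G" and T_inv: "\<And>t. t \<in> T \<Longrightarrow> inv t \<in> T"
    and u: "u \<in> carrier G" and v: "v \<in> carrier G"
  shows "pre_digraph.graph_distance (with_proj (cayley_graph G T)) u v = word_length T (v \<otimes> inv u)"
proof -
  interpret pair_wf_digraph "cayley_graph G T"
    by unfold_locales (use T in \<open>auto simp: cayley_graph_def\<close>)
  have verts [simp]: "pverts (cayley_graph G T) = carrier G"
    by (simp add: cayley_graph_def)
  \<comment> \<open>Closure under inverses gives the reversed arcs the form
    \<open>(g, t \<otimes> g)\<close> as well.\<close>
  have arcs: "(g, h) \<in> parcs (cayley_graph G T) \<longleftrightarrow> g \<in> carrier G \<and> (\<exists>t\<in>T. h = t \<otimes> g)" for g h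
  proof -
    have "g = inv t \<otimes> (t \<otimes> g)" if "g \<in> carrier G" "t \<in> T" for g t
      using that T by (auto simp flip: m_assoc)
    then show ?thesis
      using T T_inv by (fastforce simp: cayley_graph_def)
  qed
  have walk: "(\<exists>p. awalk u p v \<and> length p = k) \<longleftrightarrow>
      (\<exists>xs. set xs \<subseteq> T \<and> length xs = k \<and> mult_list G xs \<otimes> u = v)"
    if "u \<in> carrier G" for k u
    using that
  proof (induction k arbitrary: u)
    case 0
    then show ?case by (auto simp: awalk_Nil_iff)
  next
    case (Suc k)
    have "(\<exists>p. awalk u p v \<and> length p = Suc k) \<longleftrightarrow> (\<exists>e p. awalk u (e # p) v \<and> length p = k)"
      by (metis length_Suc_conv)
    also have "\<dots> \<longleftrightarrow>
        (\<exists>e p. e \<in> parcs (cayley_graph G T) \<and> u = fst e \<and> awalk (snd e) p v \<and> length p = k)"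
      by (simp add: awalk_Cons_iff conj_assoc)
    also have "\<dots> \<longleftrightarrow> (\<exists>t\<in>T. \<exists>p. awalk (t \<otimes> u) p v \<and> length p = k)"
      using Suc.prems by (auto simp: arcs split_paired_Ex)
    also have "\<dots> \<longleftrightarrow> (\<exists>t\<in>T. \<exists>xs. set xs \<subseteq> T \<and> length xs = k \<and> mult_list G xs \<otimes> (t \<otimes> u) = v)"
      by (intro bex_cong refl Suc.IH m_closed) (use Suc.prems T in auto)
    \<comment> \<open>Steps multiply on the left, so the first step of the walk is the last factor
      of the product.\<close>
    also have "\<dots> \<longleftrightarrow> (\<exists>t\<in>T. \<exists>xs. set xs \<subseteq> T \<and> length xs = k \<and> mult_list G (xs @ [t]) \<otimes> u = v)"
    proof -
      have snoc: "mult_list G (xs @ [t]) \<otimes> u = mult_list G xs \<otimes> (t \<otimes> u)" if "t \<in> T" "set xs \<subseteq> T" for t xs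
      proof -
        have "t \<in> carrier G" "set xs \<subseteq> carrier G" using that T by auto
        then show ?thesis using Suc.prems by (simp add: mult_list_append m_assoc)
      qed
      show ?thesis
        by (intro bex_cong refl arg_cong[where f = Ex] ext conj_cong) (simp_all add: snoc)
    qed
    also have "\<dots> \<longleftrightarrow> (\<exists>xs. set xs \<subseteq> T \<and> length xs = Suc k \<and> mult_list G xs \<otimes> u = v)"
    proof
      assume "\<exists>t\<in>T. \<exists>xs. set xs \<subseteq> T \<and> length xs = k \<and> mult_list G (xs @ [t]) \<otimes> u = v"
      then obtain t xs where "t \<in> T" "set xs \<subseteq> T" "length xs = k" "mult_list G (xs @ [t]) \<otimes> u = v"
        by blast
      then show "\<exists>xs. set xs \<subseteq> T \<and> length xs = Suc k \<and> mult_list G xs \<otimes> u = v"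
        by (intro exI[of _ "xs @ [t]"]) simp
    next
      assume "\<exists>xs. set xs \<subseteq> T \<and> length xs = Suc k \<and> mult_list G xs \<otimes> u = v"
      then obtain ys where ys: "set ys \<subseteq> T" "length ys = Suc k" "mult_list G ys \<otimes> u = v"
        by blast
      then obtain xs t where "ys = xs @ [t]"
        by (cases ys rule: rev_cases) auto
      then show "\<exists>t\<in>T. \<exists>xs. set xs \<subseteq> T \<and> length xs = k \<and> mult_list G (xs @ [t]) \<otimes> u = v"
        using ys by (intro bexI[of _ t] exI[of _ xs]) simp_all
    qed
    finally show ?case .
  qed
  have solve: "mult_list G xs \<otimes> u = v \<longleftrightarrow> mult_list G xs = v \<otimes> inv u" if "set xs \<subseteq> T" for xs
    using inv_solve_right[of "mult_list G xs" v u] mult_list_closed[of xs] that T u v by auto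
  have "graph_distance u v = (LEAST k. \<exists>p. awalk u p v \<and> length p = k)"
    unfolding graph_distance_def
  proof (rule Least_eq_if_dominated)
    fix k assume "\<exists>p. apath u p v \<and> length p = k"
    then show "\<exists>p. awalk u p v \<and> length p = k" using awalkI_apath by blast
  next
    fix k assume "\<exists>p. awalk u p v \<and> length p = k"
    then obtain p where p: "awalk u p v" "length p = k" by blast
    \<comment> \<open>The shortened walk has distinct arcs, all of them among those of
      \<open>p\<close>, so it is no longer than \<open>p\<close>.\<close>
    let ?q = "awalk_to_apath p"
    have q: "apath u ?q v" using p(1) by (rule apath_awalk_to_apath)
    then have "distinct ?q" using distinct_verts_imp_distinct by (auto simp: apath_def)
    then have "length ?q = card (set ?q)" by (simp add: distinct_card)
    also have "\<dots> \<le> card (set p)"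
      using awalk_to_apath_subset[OF p(1)] by (simp add: card_mono)
    also have "\<dots> \<le> k" using p(2) card_length by blast
    finally show "\<exists>j\<le>k. \<exists>p. apath u p v \<and> length p = j" using q by blast
  qed
  also have "\<dots> = word_length T (v \<otimes> inv u)"
    unfolding word_length_def walk[OF u]
    by (intro arg_cong[where f = Least] arg_cong[where f = Ex] ext conj_cong refl solve)
  finally show ?thesis .
qed

text \<open>Word length is invariant under conjugation and coprime powers, so an eigenvector read as
  a function on the group shows that \<open>x\<close> is rational. As an eigenvalue of an integer
  matrix, \<open>x\<close> is also an algebraic integer.\<close>

theorem distance_integral_cayley_graph:
  assumes fin: "finite (carrier G)" and T: "T \<subseteq> carrier G"
    and T_conj: "\<And>w t. w \<in> carrier G \<Longrightarrow> t \<in> T \<Longrightarrow> w \<otimes> t \<otimes> inv w \<in> T"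
    and T_pow: "\<And>a t. coprime a (Coset.order G) \<Longrightarrow> t \<in> T \<Longrightarrow> t [^] (a::nat) \<in> T"
  shows "pre_digraph.distance_integral (with_proj (cayley_graph G T))"
proof -
  let ?C = "with_proj (cayley_graph G T)"
  let ?P = "\<lambda>k g. \<exists>xs. set xs \<subseteq> T \<and> length xs = k \<and> mult_list G xs = g"
  \<comment> \<open>The inverse is the power with exponent one less than the order, which is coprime
    to the order.\<close>
  have T_inv: "inv t \<in> T" if t: "t \<in> T" for t
  proof -
    have "coprime (Coset.order G - 1) (Coset.order G)"
      using fin by (intro coprime_diff_one_left_nat) (simp add: order_gt_0_iff_finite)
    then have "t [^] (Coset.order G - 1) \<in> T" using T_pow t by blast
    moreover have "t [^] (Coset.order G - 1) \<otimes> t = \<one>"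
      using t T fin order_gt_0_iff_finite pow_order_eq_1
      by (metis Suc_diff_1 nat_pow_Suc subsetD)
    ultimately show ?thesis
      using t T by (metis inv_equality subsetD)
  qed
  have mult_list_conj: "mult_list G (map (\<lambda>t. w \<otimes> t \<otimes> inv w) xs) = w \<otimes> mult_list G xs \<otimes> inv w"
    if w: "w \<in> carrier G" and "set xs \<subseteq> carrier G" for w xs
    using that(2)
  proof (induction xs)
    case (Cons x xs)
    then have x: "x \<in> carrier G" "mult_list G xs \<in> carrier G" by auto
    have "w \<otimes> x \<otimes> inv w \<otimes> (w \<otimes> mult_list G xs \<otimes> inv w) =
        w \<otimes> x \<otimes> (inv w \<otimes> w) \<otimes> (mult_list G xs \<otimes> inv w)"
      using w x by (simp only: m_assoc m_closed inv_closed)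
    then show ?case using Cons w x by (simp add: m_assoc)
  qed (use w in simp)
  have P_conj: "?P k (w \<otimes> g \<otimes> inv w)" if w: "w \<in> carrier G" and P: "?P k g" for k w g
  proof -
    obtain xs where xs: "set xs \<subseteq> T" "length xs = k" "mult_list G xs = g" using P by blast
    have "mult_list G (map (\<lambda>t. w \<otimes> t \<otimes> inv w) xs) = w \<otimes> g \<otimes> inv w"
      using mult_list_conj[OF w] xs T by blast
    moreover have "set (map (\<lambda>t. w \<otimes> t \<otimes> inv w) xs) \<subseteq> T" using xs T_conj[OF w] by auto
    ultimately show ?thesis using xs(2) by (metis length_map)
  qed
  have length_conj: "word_length T (w \<otimes> g \<otimes> inv w) = word_length T g"
    if "w \<in> carrier G" "g \<in> carrier G" for w g
  proof -
    have "inv w \<otimes> (w \<otimes> g \<otimes> inv w) \<otimes> inv (inv w) = (inv w \<otimes> w) \<otimes> g \<otimes> (inv w \<otimes> w)"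
      using that by (simp only: m_assoc inv_inv m_closed inv_closed)
    then have "inv w \<otimes> (w \<otimes> g \<otimes> inv w) \<otimes> inv (inv w) = g"
      using that by simp
    then have "?P k (w \<otimes> g \<otimes> inv w) \<longleftrightarrow> ?P k g" for k
      using P_conj[of w k g] P_conj[of "inv w" k "w \<otimes> g \<otimes> inv w"] that by auto
    then show ?thesis by (simp add: word_length_def)
  qed
  have length_pow: "word_length T (g [^] a) = word_length T g"
    if a: "coprime a (Coset.order G)" and g: "g \<in> carrier G" for a :: nat and g
  proof -
    obtain b :: nat where b: "coprime b (Coset.order G)"
        "\<And>g. g \<in> carrier G \<Longrightarrow> (g [^] a) [^] b = g"
      using coprime_power_inverse[OF fin a] by blast
    have "?P k (g [^] a) \<longleftrightarrow> ?P k g" for k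
      using factorization_pow_coprime[OF fin T T_conj T_pow a, of k g]
        factorization_pow_coprime[OF fin T T_conj T_pow b(1), of k "g [^] a"] b(2)[OF g] by auto
    then show ?thesis by (simp add: word_length_def)
  qed
  have "x \<in> \<int>" if vs: "distinct vs" "set vs = carrier G"
    and ev: "eigenvalue (pre_digraph.distance_matrix ?C vs) x" for vs x
  proof -
    let ?n = "length vs"
    let ?D = "pre_digraph.distance_matrix ?C vs"
    have vs_carrier: "vs ! i \<in> carrier G" if "i < ?n" for i
      using that vs(2) by (metis nth_mem)
    have D_carrier: "?D \<in> carrier_mat ?n ?n"
      by (simp add: pre_digraph.distance_matrix_def)
    have D_entry: "?D $$ (i, j) = of_nat (word_length T (vs ! j \<otimes> inv (vs ! i)))"
      if "i < ?n" "j < ?n" for i j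
      using that by (simp add: pre_digraph.distance_matrix_def
          graph_distance_cayley_graph[OF T T_inv] vs_carrier)
    obtain v where v: "v \<in> carrier_vec ?n" "v \<noteq> 0\<^sub>v ?n" "?D *\<^sub>v v = x \<cdot>\<^sub>v v"
      using ev D_carrier by (auto simp: eigenvalue_def eigenvector_def)
    \<comment> \<open>The eigenvector as a function on the group; as \<open>vs\<close> is distinct,
      at most one index contributes.\<close>
    define f where "f g = (\<Sum>i<?n. if vs ! i = g then v $ i else 0)" for g
    have f_vs: "f (vs ! i) = v $ i" if "i < ?n" for i
    proof -
      have "f (vs ! i) = (\<Sum>j<?n. if j = i then v $ j else 0)"
        unfolding f_def by (rule sum.cong) (use that vs in \<open>auto simp: nth_eq_iff_index_eq\<close>)
      then show ?thesis using that by simp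
    qed
    have "x \<in> \<rat>"
    proof (rule Rats_convolution_eigenvalue[OF fin length_conj length_pow, of f x])
      fix g assume g: "g \<in> carrier G"
      then obtain i where i: "i < ?n" "vs ! i = g"
        using vs by (metis in_set_conv_nth)
      \<comment> \<open>Substituting \<open>h = w \<otimes> g\<close> turns the convolution at
        \<open>g = vs ! i\<close> into row \<open>i\<close> of the matrix applied to
        \<open>v\<close>.\<close>
      have bij: "bij_betw (\<lambda>w. w \<otimes> inv g) (carrier G) (carrier G)"
        by (rule bij_betwI[where g = "\<lambda>w. w \<otimes> g"]) (use g in \<open>auto simp: m_assoc\<close>)
      have "(\<Sum>w\<in>carrier G. of_nat (word_length T w) * f (w \<otimes> g)) =
          (\<Sum>h\<in>carrier G. of_nat (word_length T (h \<otimes> inv g)) * f (h \<otimes> inv g \<otimes> g))"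
        by (rule sum.reindex_bij_betw[OF bij, symmetric])
      also have "\<dots> = (\<Sum>h\<in>carrier G. of_nat (word_length T (h \<otimes> inv g)) * f h)"
        by (rule sum.cong) (use g in \<open>auto simp: m_assoc\<close>)
      also have "\<dots> = (\<Sum>j<?n. of_nat (word_length T (vs ! j \<otimes> inv g)) * f (vs ! j))"
        by (rule sum.reindex_bij_betw[OF bij_betw_nth[OF vs(1) refl vs(2)[symmetric]], symmetric])
      also have "\<dots> = (\<Sum>j<?n. ?D $$ (i, j) * v $ j)"
        by (rule sum.cong) (use i in \<open>auto simp: D_entry f_vs\<close>)
      also have "\<dots> = (?D *\<^sub>v v) $ i"
        using v(1) D_carrier i by (auto simp: scalar_prod_def atLeast0LessThan intro!: sum.cong)
      also have "\<dots> = x * f g"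
        using v i f_vs by auto
      finally show "(\<Sum>w\<in>carrier G. of_nat (word_length T w) * f (w \<otimes> g)) = x * f g" .
    next
      obtain i where "i < ?n" "v $ i \<noteq> 0"
        using v(1,2) by (metis carrier_vecD eq_vecI index_zero_vec)
      then show "\<exists>g\<in>carrier G. f g \<noteq> 0"
        using vs_carrier f_vs by metis
    qed
    moreover have "algebraic_int x"
    proof -
      \<comment> \<open>The same matrix over the integers shows that the characteristic polynomial
        is monic with integer coefficients.\<close>
      let ?A = "mat ?n ?n (\<lambda>(i, j). int (word_length T (vs ! j \<otimes> inv (vs ! i))))"
      have A: "?A \<in> carrier_mat ?n ?n" by simp
      have "?D = map_mat of_int ?A"
        by (rule eq_matI) (use D_entry D_carrier in auto)
      then have "char_poly ?D = map_poly of_int (char_poly ?A)"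
        using of_int_hom.char_poly_hom[OF A] by simp
      moreover have "poly (char_poly ?D) x = 0"
        using ev eigenvalue_root_char_poly[OF D_carrier] by simp
      moreover have "lead_coeff (char_poly ?A) = 1"
        using degree_monic_char_poly[OF A] by simp
      ultimately show ?thesis
        unfolding algebraic_int_altdef_ipoly by metis
    qed
    ultimately show ?thesis
      using rational_algebraic_int_is_int by blast
  qed
  moreover have "verts ?C = carrier G"
    by (simp add: cayley_graph_def)
  ultimately show ?thesis
    using fin by (auto simp: pre_digraph.distance_integral_def)
qed

end

section \<open>Reflection groups\<close>

context vector_space
begin

lemma group_general_linear_group: "group general_linear_group"
proof (rule groupI)
  fix f g assume "f \<in> carrier general_linear_group" "g \<in> carrier general_linear_group"
  then show "f \<otimes>\<^bsub>general_linear_group\<^esub> g \<in> carrier general_linear_group"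
    using module_hom_compose[of scale scale g scale f]
    by (auto simp: general_linear_group_def linear_iff_module_hom o_def intro: bij_comp[unfolded o_def])
next
  fix f assume f: "f \<in> carrier general_linear_group"
  show "\<exists>g\<in>carrier general_linear_group.
      g \<otimes>\<^bsub>general_linear_group\<^esub> f = \<one>\<^bsub>general_linear_group\<^esub>"
    by (rule bexI[of _ "inv_into UNIV f"])
       (use f in \<open>auto simp: general_linear_group_def bij_imp_bij_inv bij_is_inj
          linear_iff_module_hom bij_module_hom_imp_inv_module_hom\<close>)
qed (auto simp: general_linear_group_def o_assoc intro: linear_ident[folded id_def])

lemma nat_pow_general_linear_group:
  "f [^]\<^bsub>general_linear_group\<lparr>carrier := W\<rparr>\<^esub> (k::nat) = f ^^ k"
proof (induction k)
  case (Suc k)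
  then show ?case by (simp add: nat_pow_def general_linear_group_def funpow_Suc_right del: funpow.simps)
qed (simp add: nat_pow_def general_linear_group_def)

end

text \<open>The injective map \<open>w\<close> carries the fixed space of \<open>t\<close> onto that
  of the conjugate.\<close>

lemma (in finite_dimensional_vector_space) dim_fixed_conj:
  assumes w: "Vector_Spaces.linear scale scale w" and inv: "w \<circ> w' = id" "w' \<circ> w = id"
  shows "dim {v. (w \<circ> t \<circ> w') v = v} = dim {v. t v = v}"
proof -
  interpret finite_dimensional_vector_space_pair_1 scale Basis scale ..
  have w': "w (w' v) = v" "w' (w v) = v" for v
    using inv by (metis comp_apply id_apply)+
  have "{v. (w \<circ> t \<circ> w') v = v} = w ` {v. t v = v}"
  proof (intro equalityI subsetI)
    fix v assume "v \<in> {v. (w \<circ> t \<circ> w') v = v}"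
    then have "t (w' v) = w' v" by simp (metis w')
    then show "v \<in> w ` {v. t v = v}" by (intro image_eqI[of _ _ "w' v"]) (simp_all add: w')
  qed (auto simp: w')
  moreover have "inj w" by (metis injI w'(2))
  ultimately show ?thesis
    using dim_image_eq[OF w] by (simp add: inj_on_subset)
qed

theorem theorem5p4:
  fixes scale :: "complex \<Rightarrow> 'v::ab_group_add \<Rightarrow> 'v"
    and Basis :: "'v set"
    and form :: "'v \<Rightarrow> 'v \<Rightarrow> complex"
    and W T :: "('v \<Rightarrow> 'v) set"
  assumes "irreducible_complex_reflection_group scale Basis form W"
    and "T = {t \<in> W. vector_space.reflection scale t}"
  shows "pre_digraph.distance_integral
           (with_proj (cayley_graph
             ((vector_space.general_linear_group scale)\<lparr>carrier := W\<rparr>) T))"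
proof -
  interpret irreducible_complex_reflection_group scale Basis form W by fact
  interpret GL: group general_linear_group by (rule group_general_linear_group)
  define G where "G = general_linear_group\<lparr>carrier := W\<rparr>"
  interpret G: group G
    unfolding G_def using subgroup_GL by (rule subgroup.subgroup_is_group) (rule GL.group_axioms)
  have carrier [simp]: "carrier G = W" and mult [simp]: "f \<otimes>\<^bsub>G\<^esub> g = f \<circ> g"
    and one [simp]: "\<one>\<^bsub>G\<^esub> = id" for f g
    by (simp_all add: G_def general_linear_group_def)
  have pow [simp]: "f [^]\<^bsub>G\<^esub> (k::nat) = f ^^ k" for f k
    unfolding G_def by (rule nat_pow_general_linear_group)
  have W_linear: "Vector_Spaces.linear scale scale w" if "w \<in> W" for w
    using subgroup.mem_carrier[OF subgroup_GL that] by (simp add: general_linear_group_def)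
  have W_finite_order: "\<exists>k>0. w ^^ k = id" if "w \<in> W" for w
    using G.pow_order_eq_1[of w] that finite_group G.order_gt_0_iff_finite
    by (intro exI[of _ "Coset.order G"]) simp
  \<comment> \<open>Elements of the finite group \<open>W\<close> are linear of finite order, so
    only the dimension condition remains to be checked.\<close>
  have reflectionI: "w \<in> T" if "w \<in> W" "dim {v. w v = v} + 1 = dim UNIV" for w
    using that W_linear W_finite_order assms(2) by (auto simp: reflection_def)
  have T: "t \<in> W" "dim {v. t v = v} + 1 = dim UNIV" if "t \<in> T" for t
    using that assms(2) by (auto simp: reflection_def)
  have "pre_digraph.distance_integral (with_proj (cayley_graph G T))"
  proof (rule G.distance_integral_cayley_graph)
    show "finite (carrier G)" using finite_group by simp
    show "T \<subseteq> carrier G" using T(1) by auto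
  next
    fix w t assume w: "w \<in> carrier G" and t: "t \<in> T"
    let ?w' = "inv\<^bsub>G\<^esub> w"
    have "w \<circ> ?w' = id" "?w' \<circ> w = id"
      using G.r_inv[OF w] G.l_inv[OF w] by simp_all
    then have "dim {v. (w \<circ> t \<circ> ?w') v = v} = dim {v. t v = v}"
      using w by (intro dim_fixed_conj W_linear) simp_all
    moreover have "w \<circ> t \<circ> ?w' \<in> W"
      using G.m_closed[OF G.m_closed[OF w, of t] G.inv_closed[OF w]] T(1)[OF t] by simp
    ultimately show "w \<otimes>\<^bsub>G\<^esub> t \<otimes>\<^bsub>G\<^esub> ?w' \<in> T"
      using T(2)[OF t] by (intro reflectionI) simp_all
  next
    fix a :: nat and t assume a: "coprime a (Coset.order G)" and t: "t \<in> T"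
    obtain b :: nat where b: "\<And>x. x \<in> carrier G \<Longrightarrow> (x [^]\<^bsub>G\<^esub> a) [^]\<^bsub>G\<^esub> b = x"
      using G.coprime_power_inverse[OF _ a] finite_group by auto
    have fixed_pow: "(f ^^ k) v = v" if "f v = v" for f :: "'v \<Rightarrow> 'v" and k v
      using that by (induction k) auto
    \<comment> \<open>As \<open>t\<close> is in turn a power of \<open>t ^^ a\<close>, both fix the
      same vectors.\<close>
    have "((t ^^ a) ^^ b) v = t v" for v
      using b[of t] T(1)[OF t] by simp
    then have "{v. (t ^^ a) v = v} = {v. t v = v}"
      using fixed_pow by (metis (no_types, lifting))
    moreover have "t ^^ a \<in> W"
      using G.nat_pow_closed[of t a] T(1)[OF t] by simp
    ultimately show "t [^]\<^bsub>G\<^esub> a \<in> T"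
      using T(2)[OF t] by (intro reflectionI) simp_all
  qed
  then show ?thesis by (simp only: G_def)
qed

end
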